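(* Let $(U_N^n,\Phi_N^n,\Psi_N^n,P^n)_{0\le n\le N_t}$ be a solution of the ESAV-SGM scheme (defined in the context), with $U_N^n\in X_N^0(\Omega)$ complex-valued, $\Phi_N^n,\Psi_N^n\in X_N^0(\Omega)$ real-valued and $P^n>0$. Put $$\mathcal{E}^n=\|\Psi_N^n\|^2+\gamma|\Phi_N^n|_{\alpha/2}^2+\eta^2\|\Phi_N^n\|^2+\lambda|U_N^n|_{\alpha/2}^2-\ln(P^n).$$ Then $\mathcal{E}^n=\mathcal{E}^0$ for all $n=0,1,\dots,N_t$.
   Context: Parameters: $\Omega=(a,b)$ is a bounded interval, $1<\alpha<2$, $T>0$, $\lambda,\kappa_1,\kappa_2,\gamma\ge 0$, $\eta\in\mathbb{R}$. Norms: $(u,v)=\int_\Omega u\bar v\,dx$, $\|u\|=\sqrt{(u,u)}$. $H_0^{\mu}(\Omega)$ is the fractional Sobolev space of order $\mu$ obtained as the closure of $C_0^\infty(\Omega)$ in the $H^\mu$ norm. Bilinear form: for $0<\mu<1$ put ${}_aD_x^{\mu}u=\frac{1}{\Gamma(1-\mu)}\frac{d}{dx}\int_a^x\frac{u(\xi)\,d\xi}{(x-\xi)^{\mu}}$ and ${}_xD_b^{\mu}u=-\frac{1}{\Gamma(1-\mu)}\frac{d}{dx}\int_x^b\frac{u(\xi)\,d\xi}{(\xi-x)^{\mu}}$. For $u,w\in H_0^{\alpha/2}(\Omega)$, $$\mathcal{B}(u,w)=\frac{1}{2\cos(\alpha\pi/2)}\Big(({}_aD_x^{\alpha/2}u,{}_xD_b^{\alpha/2}w)+({}_xD_b^{\alpha/2}u,{}_aD_x^{\alpha/2}w)\Big),\qquad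 |u|_{\alpha/2}=\sqrt{\mathcal{B}(u,u)} .$$ Discrete space: $P_N(\Omega)$ is the space of polynomials of degree at most $N$ on $\Omega$, and $X_N^0(\Omega)=P_N(\Omega)\cap H_0^{\alpha/2}(\Omega)$. The projection $\Pi_N^{\alpha/2,0}:H_0^{\alpha/2}(\Omega)\to X_N^0(\Omega)$ is defined by $\mathcal{B}(u-\Pi_N^{\alpha/2,0}u,w_N)=0$ for all $w_N\in X_N^0(\Omega)$. Time grid: $\tau=T/N_t$; for a sequence $v^n$, $\delta_t v^{n+1/2}=(v^{n+1}-v^n)/\tau$, $v^{n+1/2}=(v^{n+1}+v^n)/2$ and $\widetilde v^{\,n+1/2}=(3v^n-v^{n-1})/2$. Nonlinear functions: $$F(u,\phi)=\frac{\kappa_1+2\kappa_2|u|^2}{\exp\big(2\int_\Omega(\kappa_1|u|^2+\kappa_2|u|^4)\phi\,dx\big)},\qquad G(u,\phi)=\frac{\kappa_1|u|^2+\kappa_2|u|^4}{\exp\big(2\int_\Omega(\kappa_1|u|^2+\kappa_2|u|^4)\phi\,dx\big)} .$$ ESAV-SGM scheme: for $n=1,\dots,N_t-1$ and all $w_N\in X_N^0(\Omega)$, $$\mathrm{i}(\delta_tU_N^{n+1/2},w_N)-\tfrac{\lambda}{2}\mathcal{B}(U_N^{n+1/2},w_N)+\widetilde P^{n+1/2}\big(F(\widetilde U_N^{n+1/2},\widetilde\Phi_N^{n+1/2})\widetilde U_N^{n+1/2}\widetilde\Phi_N^{n+1/2},w_N\big)=0,$$ $$(\delta_t\Phi_N^{n+1/2},w_N)=(\Psi_N^{n+1/2},w_N),$$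 $$(\delta_t\Psi_N^{n+1/2},w_N)+\gamma\mathcal{B}(\Phi_N^{n+1/2},w_N)+\eta^2(\Phi_N^{n+1/2},w_N)-\widetilde P^{n+1/2}\big(G(\widetilde U_N^{n+1/2},\widetilde\Phi_N^{n+1/2}),w_N\big)=0,$$ $$\frac{\ln(P^{n+1})-\ln(P^n)}{\tau}=4\widetilde P^{n+1/2}\,\mathrm{Re}\big(F(\widetilde U_N^{n+1/2},\widetilde\Phi_N^{n+1/2})\widetilde U_N^{n+1/2}\widetilde\Phi_N^{n+1/2},\delta_tU_N^{n+1/2}\big)+2\widetilde P^{n+1/2}\big(G(\widetilde U_N^{n+1/2},\widetilde\Phi_N^{n+1/2}),\delta_t\Phi_N^{n+1/2}\big).$$ The first step ($n=0$) is given by the same four equations with every extrapolated quantity $\widetilde U_N^{1/2},\widetilde\Phi_N^{1/2},\widetilde P^{1/2}$ replaced by the average $U_N^{1/2}=(U_N^1+U_N^0)/2$, $\Phi_N^{1/2}=(\Phi_N^1+\Phi_N^0)/2$, $P^{1/2}=(P^1+P^0)/2$. The initial values are $U_N^0=\Pi_N^{\alpha/2,0}u_0$, $\Phi_N^0=\Pi_N^{\alpha/2,0}\phi_0$, $\Psi_N^0=\Pi_N^{\alpha/2,0}\phi_1$ and $P^0=\exp\big(2\int_\Omega(\kappa_1|u_0|^2+\kappa_2|u_0|^4)\phi_0\,dx\big)$, where $u_0$ (complex-valued), $\phi_0,\phi_1$ (real-valued) are given smooth functions in $H_0^{\alpha/2}(\Omega)$. *)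

theory Defs
  imports "HOL-Analysis.Analysis" "HOL-Computational_Algebra.Polynomial"
begin

text \<open>
  Functions on the interval \<open>{a<..<b}\<close> are represented by total functions on the reals of which
  only the values on that interval are used.  The function spaces consist of complex-valued
  functions; real-valued functions are regarded as members of them via \<open>cfun\<close>.
\<close>

abbreviation cfun :: "(real \<Rightarrow> real) \<Rightarrow> real \<Rightarrow> complex" where
  "cfun f \<equiv> (\<lambda>x. complex_of_real (f x))"

definition ip :: "real \<Rightarrow> real \<Rightarrow> (real \<Rightarrow> complex) \<Rightarrow> (real \<Rightarrow> complex) \<Rightarrow> complex" where
  "ip a b u v = (LINT x|lebesgue_on {a<..<b}. u x * cnj (v x))"

definition l2norm :: "real \<Rightarrow> real \<Rightarrow> (real \<Rightarrow> complex) \<Rightarrow> real" where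
  "l2norm a b u = sqrt (Re (ip a b u u))"

definition smooth_on :: "(real \<Rightarrow> 'a::real_normed_vector) \<Rightarrow> real set \<Rightarrow> bool" where
  "smooth_on f S \<longleftrightarrow>
    (\<exists>D :: nat \<Rightarrow> real \<Rightarrow> 'a.
      (\<forall>x\<in>S. D 0 x = f x) \<and>
      (\<forall>k. \<forall>x\<in>S. (D k has_vector_derivative D (Suc k) x) (at x within S)))"

definition test_functions :: "real \<Rightarrow> real \<Rightarrow> (real \<Rightarrow> complex) set" where
  "test_functions a b =
    {\<phi>. smooth_on \<phi> UNIV \<and> (\<exists>K. compact K \<and> K \<subseteq> {a<..<b} \<and> (\<forall>x. x \<notin> K \<longrightarrow> \<phi> x = 0))}"

text \<open>The squared Sobolev--Slobodeckij (Gagliardo) norm of order \<open>0 < \<mu> < 1\<close>, possibly infinite.\<close>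

definition H_norm_sq :: "real \<Rightarrow> real \<Rightarrow> real \<Rightarrow> (real \<Rightarrow> complex) \<Rightarrow> ennreal" where
  "H_norm_sq \<mu> a b u =
    (\<integral>\<^sup>+x. ennreal ((cmod (u x))\<^sup>2) \<partial>lebesgue_on {a<..<b}) +
    (\<integral>\<^sup>+x. (\<integral>\<^sup>+y. ennreal ((cmod (u x - u y))\<^sup>2 / \<bar>x - y\<bar> powr (1 + 2 * \<mu>))
        \<partial>lebesgue_on {a<..<b}) \<partial>lebesgue_on {a<..<b})"

definition H_space :: "real \<Rightarrow> real \<Rightarrow> real \<Rightarrow> (real \<Rightarrow> complex) set" where
  "H_space \<mu> a b = {u. u \<in> borel_measurable (lebesgue_on {a<..<b}) \<and> H_norm_sq \<mu> a b u < \<infinity>}"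

definition H_norm :: "real \<Rightarrow> real \<Rightarrow> real \<Rightarrow> (real \<Rightarrow> complex) \<Rightarrow> real" where
  "H_norm \<mu> a b u = sqrt (enn2real (H_norm_sq \<mu> a b u))"

definition H0_space :: "real \<Rightarrow> real \<Rightarrow> real \<Rightarrow> (real \<Rightarrow> complex) set" where
  "H0_space \<mu> a b =
    {u \<in> H_space \<mu> a b. \<forall>\<epsilon>>0. \<exists>\<phi>\<in>test_functions a b. H_norm \<mu> a b (\<lambda>x. u x - \<phi> x) < \<epsilon>}"

text \<open>
  The left and right Riemann--Liouville derivatives of order \<open>0 < \<mu> < 1\<close>.  The constant
  \<open>vector_derivative\<close> has an unspecified value at points where the derivative does not exist.
\<close>

definition RL_left :: "real \<Rightarrow> real \<Rightarrow> (real \<Rightarrow> complex) \<Rightarrow> real \<Rightarrow> complex" where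
  "RL_left a \<mu> u x =
    complex_of_real (1 / Gamma (1 - \<mu>)) *
    vector_derivative
      (\<lambda>y. LINT \<xi>|lebesgue_on {a<..<y}. u \<xi> / complex_of_real ((y - \<xi>) powr \<mu>)) (at x)"

definition RL_right :: "real \<Rightarrow> real \<Rightarrow> (real \<Rightarrow> complex) \<Rightarrow> real \<Rightarrow> complex" where
  "RL_right b \<mu> u x =
    - complex_of_real (1 / Gamma (1 - \<mu>)) *
    vector_derivative
      (\<lambda>y. LINT \<xi>|lebesgue_on {y<..<b}. u \<xi> / complex_of_real ((\<xi> - y) powr \<mu>)) (at x)"

definition bform ::
  "real \<Rightarrow> real \<Rightarrow> real \<Rightarrow> (real \<Rightarrow> complex) \<Rightarrow> (real \<Rightarrow> complex) \<Rightarrow> complex" where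
  "bform a b \<alpha> u w =
    complex_of_real (1 / (2 * cos (\<alpha> * pi / 2))) *
    (ip a b (RL_left a (\<alpha> / 2) u) (RL_right b (\<alpha> / 2) w) +
     ip a b (RL_right b (\<alpha> / 2) u) (RL_left a (\<alpha> / 2) w))"

text \<open>
  The number \<open>bform a b \<alpha> u u\<close> is a real multiple of \<open>(f, g) + (g, f)\<close>, hence real; taking the
  real part only changes its type.
\<close>

definition frac_seminorm :: "real \<Rightarrow> real \<Rightarrow> real \<Rightarrow> (real \<Rightarrow> complex) \<Rightarrow> real" where
  "frac_seminorm a b \<alpha> u = sqrt (Re (bform a b \<alpha> u u))"

definition poly_space :: "real \<Rightarrow> real \<Rightarrow> nat \<Rightarrow> (real \<Rightarrow> complex) set" where
  "poly_space a b N =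
    {u. \<exists>p :: complex poly. degree p \<le> N \<and> (\<forall>x\<in>{a<..<b}. u x = poly p (complex_of_real x))}"

definition X0_space :: "real \<Rightarrow> real \<Rightarrow> real \<Rightarrow> nat \<Rightarrow> (real \<Rightarrow> complex) set" where
  "X0_space a b \<alpha> N = poly_space a b N \<inter> H0_space (\<alpha> / 2) a b"

text \<open>
  The projection is stated as a relation because the values of a representative outside
  \<open>{a<..<b}\<close> are not determined.
\<close>

definition is_projection ::
  "real \<Rightarrow> real \<Rightarrow> real \<Rightarrow> nat \<Rightarrow> (real \<Rightarrow> complex) \<Rightarrow> (real \<Rightarrow> complex) \<Rightarrow> bool" where
  "is_projection a b \<alpha> N u p \<longleftrightarrow>
    p \<in> X0_space a b \<alpha> N \<and> (\<forall>w\<in>X0_space a b \<alpha> N. bform a b \<alpha> (\<lambda>x. u x - p x) w = 0)"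

text \<open>
  In the scheme the following three operators are applied to scalar sequences, pointwise in \<open>x\<close>
  for sequences of functions.
\<close>

definition dquot :: "real \<Rightarrow> (nat \<Rightarrow> 'a::real_vector) \<Rightarrow> nat \<Rightarrow> 'a" where
  "dquot \<tau> v n = (v (n + 1) - v n) /\<^sub>R \<tau>"

definition avg :: "(nat \<Rightarrow> 'a::real_vector) \<Rightarrow> nat \<Rightarrow> 'a" where
  "avg v n = (v (n + 1) + v n) /\<^sub>R 2"

definition extrap :: "(nat \<Rightarrow> 'a::real_vector) \<Rightarrow> nat \<Rightarrow> 'a" where
  "extrap v n = (3 *\<^sub>R v n - v (n - 1)) /\<^sub>R 2"

definition sav_exp ::
  "real \<Rightarrow> real \<Rightarrow> real \<Rightarrow> real \<Rightarrow> (real \<Rightarrow> complex) \<Rightarrow> (real \<Rightarrow> real) \<Rightarrow> real" where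
  "sav_exp a b \<kappa>1 \<kappa>2 u \<phi> =
    exp (2 * (LINT x|lebesgue_on {a<..<b}. (\<kappa>1 * (cmod (u x))\<^sup>2 + \<kappa>2 * (cmod (u x)) ^ 4) * \<phi> x))"

definition Fnl ::
  "real \<Rightarrow> real \<Rightarrow> real \<Rightarrow> real \<Rightarrow> (real \<Rightarrow> complex) \<Rightarrow> (real \<Rightarrow> real) \<Rightarrow> real \<Rightarrow> real" where
  "Fnl a b \<kappa>1 \<kappa>2 u \<phi> x = (\<kappa>1 + 2 * \<kappa>2 * (cmod (u x))\<^sup>2) / sav_exp a b \<kappa>1 \<kappa>2 u \<phi>"

definition Gnl ::
  "real \<Rightarrow> real \<Rightarrow> real \<Rightarrow> real \<Rightarrow> (real \<Rightarrow> complex) \<Rightarrow> (real \<Rightarrow> real) \<Rightarrow> real \<Rightarrow> real" where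
  "Gnl a b \<kappa>1 \<kappa>2 u \<phi> x =
    (\<kappa>1 * (cmod (u x))\<^sup>2 + \<kappa>2 * (cmod (u x)) ^ 4) / sav_exp a b \<kappa>1 \<kappa>2 u \<phi>"

text \<open>
  One time step from level \<open>n\<close> to level \<open>n + 1\<close>; \<open>Ut\<close>, \<open>\<Phi>t\<close>, \<open>Pt\<close> are the explicit
  approximations at level \<open>n + 1/2\<close> (extrapolations, or averages in the first step).
\<close>

definition esav_step ::
  "real \<Rightarrow> real \<Rightarrow> real \<Rightarrow> nat \<Rightarrow> real \<Rightarrow> real \<Rightarrow> real \<Rightarrow> real \<Rightarrow> real \<Rightarrow> real \<Rightarrow>
   (nat \<Rightarrow> real \<Rightarrow> complex) \<Rightarrow> (nat \<Rightarrow> real \<Rightarrow> real) \<Rightarrow> (nat \<Rightarrow> real \<Rightarrow> real) \<Rightarrow> (nat \<Rightarrow> real) \<Rightarrow>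
   nat \<Rightarrow> (real \<Rightarrow> complex) \<Rightarrow> (real \<Rightarrow> real) \<Rightarrow> real \<Rightarrow> bool" where
  "esav_step a b \<alpha> N lam \<kappa>1 \<kappa>2 \<gamma> \<eta> \<tau> U \<Phi> \<Psi> P n Ut \<Phi>t Pt \<longleftrightarrow>
    (let dU = (\<lambda>x. dquot \<tau> (\<lambda>m. U m x) n);
         d\<Phi> = (\<lambda>x. dquot \<tau> (\<lambda>m. \<Phi> m x) n);
         d\<Psi> = (\<lambda>x. dquot \<tau> (\<lambda>m. \<Psi> m x) n);
         Uh = (\<lambda>x. avg (\<lambda>m. U m x) n);
         \<Phi>h = (\<lambda>x. avg (\<lambda>m. \<Phi> m x) n);
         \<Psi>h = (\<lambda>x. avg (\<lambda>m. \<Psi> m x) n);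
         f = (\<lambda>x. complex_of_real (Fnl a b \<kappa>1 \<kappa>2 Ut \<Phi>t x) * Ut x * complex_of_real (\<Phi>t x));
         g = cfun (Gnl a b \<kappa>1 \<kappa>2 Ut \<Phi>t)
     in
      (\<forall>w\<in>X0_space a b \<alpha> N.
        \<i> * ip a b dU w - complex_of_real (lam / 2) * bform a b \<alpha> Uh w
          + complex_of_real Pt * ip a b f w = 0) \<and>
      (\<forall>w\<in>X0_space a b \<alpha> N. ip a b (cfun d\<Phi>) w = ip a b (cfun \<Psi>h) w) \<and>
      (\<forall>w\<in>X0_space a b \<alpha> N.
        ip a b (cfun d\<Psi>) w + complex_of_real \<gamma> * bform a b \<alpha> (cfun \<Phi>h) w
          + complex_of_real (\<eta>\<^sup>2) * ip a b (cfun \<Phi>h) w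
          - complex_of_real Pt * ip a b g w = 0) \<and>
      complex_of_real ((ln (P (n + 1)) - ln (P n)) / \<tau>) =
        4 * complex_of_real Pt * complex_of_real (Re (ip a b f dU))
          + 2 * complex_of_real Pt * ip a b g (cfun d\<Phi>))"

definition esav_sgm_solution ::
  "real \<Rightarrow> real \<Rightarrow> real \<Rightarrow> nat \<Rightarrow> real \<Rightarrow> real \<Rightarrow> real \<Rightarrow> real \<Rightarrow> real \<Rightarrow> real \<Rightarrow> nat \<Rightarrow>
   (real \<Rightarrow> complex) \<Rightarrow> (real \<Rightarrow> real) \<Rightarrow> (real \<Rightarrow> real) \<Rightarrow>
   (nat \<Rightarrow> real \<Rightarrow> complex) \<Rightarrow> (nat \<Rightarrow> real \<Rightarrow> real) \<Rightarrow> (nat \<Rightarrow> real \<Rightarrow> real) \<Rightarrow> (nat \<Rightarrow> real) \<Rightarrow>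
   bool" where
  "esav_sgm_solution a b \<alpha> N lam \<kappa>1 \<kappa>2 \<gamma> \<eta> T Nt u0 \<phi>0 \<phi>1 U \<Phi> \<Psi> P \<longleftrightarrow>
    (\<forall>n\<le>Nt. U n \<in> X0_space a b \<alpha> N \<and> cfun (\<Phi> n) \<in> X0_space a b \<alpha> N \<and>
       cfun (\<Psi> n) \<in> X0_space a b \<alpha> N \<and> P n > 0) \<and>
    is_projection a b \<alpha> N u0 (U 0) \<and>
    is_projection a b \<alpha> N (cfun \<phi>0) (cfun (\<Phi> 0)) \<and>
    is_projection a b \<alpha> N (cfun \<phi>1) (cfun (\<Psi> 0)) \<and>
    P 0 = sav_exp a b \<kappa>1 \<kappa>2 u0 \<phi>0 \<and>
    esav_step a b \<alpha> N lam \<kappa>1 \<kappa>2 \<gamma> \<eta> (T / real Nt) U \<Phi> \<Psi> P 0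
      (\<lambda>x. avg (\<lambda>m. U m x) 0) (\<lambda>x. avg (\<lambda>m. \<Phi> m x) 0) (avg P 0) \<and>
    (\<forall>n. 1 \<le> n \<and> n < Nt \<longrightarrow>
      esav_step a b \<alpha> N lam \<kappa>1 \<kappa>2 \<gamma> \<eta> (T / real Nt) U \<Phi> \<Psi> P n
        (\<lambda>x. extrap (\<lambda>m. U m x) n) (\<lambda>x. extrap (\<lambda>m. \<Phi> m x) n) (extrap P n))"

definition energy ::
  "real \<Rightarrow> real \<Rightarrow> real \<Rightarrow> real \<Rightarrow> real \<Rightarrow> real \<Rightarrow>
   (nat \<Rightarrow> real \<Rightarrow> complex) \<Rightarrow> (nat \<Rightarrow> real \<Rightarrow> real) \<Rightarrow> (nat \<Rightarrow> real \<Rightarrow> real) \<Rightarrow> (nat \<Rightarrow> real) \<Rightarrow>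
   nat \<Rightarrow> real" where
  "energy a b \<alpha> lam \<gamma> \<eta> U \<Phi> \<Psi> P n =
    (l2norm a b (cfun (\<Psi> n)))\<^sup>2 + \<gamma> * (frac_seminorm a b \<alpha> (cfun (\<Phi> n)))\<^sup>2
      + \<eta>\<^sup>2 * (l2norm a b (cfun (\<Phi> n)))\<^sup>2 + lam * (frac_seminorm a b \<alpha> (U n))\<^sup>2 - ln (P n)"

end

theory Submission
  imports Defs
begin

text \<open>
  The scheme is designed so that testing its equations with the right functions gives an exact
  balance.  Test the first equation with the difference quotient of \<open>U\<close> and take the real part:
  the term \<open>\<i> (\<delta>U, \<delta>U)\<close> is purely imaginary and disappears, and as the form
  is Hermitian, its real part at (mean, difference quotient) is the increment of
  \<open>B(U, U)\<close> divided by \<open>2 \<tau>\<close>.  Test the third equation with the difference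
  quotient of \<open>\<Phi>\<close> and the second one with that of \<open>\<Psi>\<close>; this gives the increments
  of the other quadratic terms.  The nonlinear terms that remain are exactly those on the right of
  the equation for \<open>ln P\<close>, whatever the explicit approximations are.  Lemma
  \<open>energy_step\<close> carries this out.

  Two facts behind this computation need proof.  First, the difference quotients must be admissible
  test functions and the form must be additive on the discrete space.  Second, the energy contains
  the square of \<open>|u| = sqrt (B(u, u))\<close>, which is \<open>B(u, u)\<close> only if \<open>B(u, u) \<ge> 0\<close>.
  Admissibility is the linearity of the discrete space (\<open>X0_space_linear_combination\<close>);
  additivity and positivity of the form rest on a formula for the fractional derivatives of the
  elements of the discrete space.

  An element of the discrete space is a polynomial \<open>p\<close> on \<open>(a, b)\<close> that lies in the
  closure of the test functions in the norm of order \<open>\<mu> = \<alpha>/2 > 1/2\<close>.  For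
  \<open>\<mu> > 1/2\<close> end point values are continuous in this norm (\<open>trace_bound\<close>; the means
  over dyadic intervals shrinking to the end point form a geometrically convergent sequence), so
  \<open>p\<close> vanishes at \<open>a\<close> and \<open>b\<close> (\<open>H0_polynomial_vanishes_at_ends\<close>).
  Therefore its left and right derivatives are, up to sign and a Gamma factor, the fractional
  integrals of order \<open>s = 1 - \<mu>\<close> of \<open>p'\<close> (\<open>RL_left_poly\<close>,
  \<open>RL_right_poly\<close>).

  For positivity (\<open>Re_RL_integral_opposite_nonneg\<close>) let \<open>k(t) = t^(s-1)\<close> for
  \<open>t > 0\<close> and \<open>k(t) = 0\<close> otherwise, and extend \<open>f = p'\<close> by zero.  By scaling,
  the integral of \<open>k(x - \<xi>) k(\<eta> - x)\<close> over \<open>x\<close> is a constant times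
  \<open>(\<eta> - \<xi>)^(2s-1)\<close> for \<open>\<xi> < \<eta>\<close> and zero for \<open>\<xi> > \<eta>\<close>,
  while that of \<open>k(x - \<xi>) k(x - \<eta>)\<close> is a positive constant times
  \<open>|\<xi> - \<eta>|^(2s-1)\<close>; it is finite exactly because \<open>s < 1/2\<close>.  So the first
  kernel, symmetrised, is a nonnegative multiple of the second one.  By Fubini's theorem, the real
  part of the pairing of the left with the right fractional integral of \<open>f\<close> is a nonnegative
  multiple of the squared norm over the whole line of the left one.  The two minus signs, from the
  right derivative and from \<open>cos (\<alpha>\<pi>/2) < 0\<close>, cancel.
\<close>

section \<open>The kernel of fractional integration\<close>

text \<open>
  The kernel of the fractional integral of order \<open>s\<close> without its factor \<open>1 / Gamma s\<close>.
  With the value zero off the positive half line, one-sided fractional integrals become integrals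
  over the whole line, so that the limits of integration need no attention in Fubini arguments.
\<close>

definition RL_kernel :: "real \<Rightarrow> real \<Rightarrow> real" where
  "RL_kernel s t = (if 0 < t then t powr (s - 1) else 0)"

lemma RL_kernel_nonneg [simp]: "0 \<le> RL_kernel s t"
  by (simp add: RL_kernel_def)

lemma RL_kernel_measurable [measurable]: "RL_kernel s \<in> borel_measurable borel"
  unfolding RL_kernel_def by measurable

lemma RL_kernel_scale: "0 < t \<Longrightarrow> RL_kernel s (t * w) = t powr (s - 1) * RL_kernel s w"
  by (auto simp: RL_kernel_def powr_mult zero_less_mult_iff)

lemma RL_kernel_le_abs: "RL_kernel s t \<le> \<bar>t\<bar> powr (s - 1)"
  by (simp add: RL_kernel_def)

lemma nn_integral_powr_from_0:
  fixes e d :: real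
  assumes "-1 < e" "0 \<le> d"
  shows "(\<integral>\<^sup>+w. ennreal (w powr e) * indicator {0..d} w \<partial>lborel) = ennreal (d powr (e + 1) / (e + 1))"
  using nn_integral_has_integral_lebesgue'[OF _ has_integral_powr_from_0[OF assms]] by simp

text \<open>
  The bound does not depend on \<open>x\<close>; it makes every weakly singular kernel used below
  integrable on bounded sets.
\<close>

lemma nn_integral_abs_powr_le:
  fixes a b e x :: real
  assumes "-1 < e" "a \<le> x" "x \<le> b"
  shows "(\<integral>\<^sup>+y. ennreal (\<bar>x - y\<bar> powr e) * indicator {a<..<b} y \<partial>lborel)
           \<le> ennreal (2 * (b - a) powr (e + 1) / (e + 1))"
proof -
  define q where "q = (\<lambda>w. ennreal (w powr e) * indicator {0..b-a} w)"
  have [measurable]: "q \<in> borel_measurable borel" unfolding q_def by measurable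
  have q: "(\<integral>\<^sup>+w. q w \<partial>lborel) = ennreal ((b-a) powr (e + 1) / (e + 1))"
    unfolding q_def using assms by (intro nn_integral_powr_from_0) auto
  have "(\<integral>\<^sup>+y. ennreal (\<bar>x - y\<bar> powr e) * indicator {a<..<b} y \<partial>lborel)
      \<le> (\<integral>\<^sup>+y. q (-x + 1 * y) + q (x + (-1) * y) \<partial>lborel)"
    using assms by (intro nn_integral_mono) (auto simp: q_def indicator_def abs_if)
  also have "\<dots> = (\<integral>\<^sup>+y. q (-x + 1 * y) \<partial>lborel) + (\<integral>\<^sup>+y. q (x + (-1) * y) \<partial>lborel)"
    by (intro nn_integral_add) auto
  also have "\<dots> = (\<integral>\<^sup>+w. q w \<partial>lborel) + (\<integral>\<^sup>+w. q w \<partial>lborel)"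
    using nn_integral_real_affine[of q 1 "-x"] nn_integral_real_affine[of q "-1" x] by simp
  also have "\<dots> = ennreal (2 * (b - a) powr (e + 1) / (e + 1))"
    using assms by (simp add: q flip: ennreal_plus)
  finally show ?thesis .
qed

text \<open>
  Substitution of \<open>x = \<xi> + (\<eta> - \<xi>) w\<close>: the kernel is homogeneous of degree
  \<open>s - 1\<close>, so the distance comes out with the exponent \<open>2 (s - 1) + 1\<close>.  The constant
  is a Beta value, but only its finiteness matters.
\<close>

lemma nn_integral_RL_kernel_opposite:
  "(\<integral>\<^sup>+x. ennreal (RL_kernel s (x - \<xi>) * RL_kernel s (\<eta> - x)) \<partial>lborel)
     = ennreal (RL_kernel (2 * s) (\<eta> - \<xi>)) * (\<integral>\<^sup>+w. ennreal (RL_kernel s w * RL_kernel s (1 - w)) \<partial>lborel)"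
proof (cases "\<xi> < \<eta>")
  case True
  define t where "t = \<eta> - \<xi>"
  have t: "0 < t" using True by (simp add: t_def)
  have *: "ennreal (RL_kernel s (\<xi> + t * w - \<xi>) * RL_kernel s (\<eta> - (\<xi> + t * w)))
      = ennreal (t powr (2 * s - 2)) * ennreal (RL_kernel s w * RL_kernel s (1 - w))" for w
  proof -
    have "\<eta> - (\<xi> + t * w) = t * (1 - w)" by (simp add: t_def algebra_simps)
    moreover have "t powr (s - 1) * t powr (s - 1) = t powr (2 * s - 2)"
      by (simp flip: powr_add)
    ultimately show ?thesis using t
      by (subst ennreal_mult'[symmetric]) (simp_all add: RL_kernel_scale mult_ac flip: mult.assoc)
  qed
  have "(\<integral>\<^sup>+x. ennreal (RL_kernel s (x - \<xi>) * RL_kernel s (\<eta> - x)) \<partial>lborel)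
     = ennreal t * (\<integral>\<^sup>+w. ennreal (t powr (2 * s - 2)) * ennreal (RL_kernel s w * RL_kernel s (1 - w)) \<partial>lborel)"
    using t by (subst nn_integral_real_affine[where c = t and t = \<xi>]) (simp_all only: * abs_of_pos, auto)
  also have "\<dots> = ennreal (t * t powr (2 * s - 2)) * (\<integral>\<^sup>+w. ennreal (RL_kernel s w * RL_kernel s (1 - w)) \<partial>lborel)"
    using t by (subst nn_integral_cmult) (auto simp: ennreal_mult' mult_ac)
  also have "t * t powr (2 * s - 2) = RL_kernel (2 * s) (\<eta> - \<xi>)"
    using t by (simp add: RL_kernel_def t_def powr_mult_base)
  finally show ?thesis .
next
  case False
  have *: "RL_kernel s (x - \<xi>) * RL_kernel s (\<eta> - x) = 0" for x
    using False by (auto simp: RL_kernel_def)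
  from False show ?thesis unfolding * by (simp add: RL_kernel_def)
qed

text \<open>
  The same homogeneity argument, with \<open>x = \<eta> + (\<eta> - \<xi>) w\<close>.
\<close>

lemma nn_integral_RL_kernel_same_ordered:
  assumes "\<xi> < \<eta>"
  shows "(\<integral>\<^sup>+x. ennreal (RL_kernel s (x - \<xi>) * RL_kernel s (x - \<eta>)) \<partial>lborel)
     = ennreal (\<bar>\<xi> - \<eta>\<bar> powr (2 * s - 1)) * (\<integral>\<^sup>+w. ennreal (RL_kernel s (1 + w) * RL_kernel s w) \<partial>lborel)"
proof -
  define t where "t = \<eta> - \<xi>"
  have t: "0 < t" using assms by (simp add: t_def)
  have *: "ennreal (RL_kernel s (\<eta> + t * w - \<xi>) * RL_kernel s (\<eta> + t * w - \<eta>))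
      = ennreal (t powr (2 * s - 2)) * ennreal (RL_kernel s (1 + w) * RL_kernel s w)" for w
  proof -
    have "\<eta> + t * w - \<xi> = t * (1 + w)" by (simp add: t_def algebra_simps)
    moreover have "t powr (s - 1) * t powr (s - 1) = t powr (2 * s - 2)"
      by (simp flip: powr_add)
    ultimately show ?thesis using t
      by (subst ennreal_mult'[symmetric]) (simp_all add: RL_kernel_scale mult_ac flip: mult.assoc)
  qed
  have "(\<integral>\<^sup>+x. ennreal (RL_kernel s (x - \<xi>) * RL_kernel s (x - \<eta>)) \<partial>lborel)
     = ennreal t * (\<integral>\<^sup>+w. ennreal (t powr (2 * s - 2)) * ennreal (RL_kernel s (1 + w) * RL_kernel s w) \<partial>lborel)"
    using t by (subst nn_integral_real_affine[where c = t and t = \<eta>]) (simp_all only: * abs_of_pos, auto)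
  also have "\<dots> = ennreal (t * t powr (2 * s - 2)) * (\<integral>\<^sup>+w. ennreal (RL_kernel s (1 + w) * RL_kernel s w) \<partial>lborel)"
    using t by (subst nn_integral_cmult) (auto simp: ennreal_mult' mult_ac)
  also have "t * t powr (2 * s - 2) = \<bar>\<xi> - \<eta>\<bar> powr (2 * s - 1)"
    using t by (simp add: t_def powr_mult_base)
  finally show ?thesis .
qed

lemma nn_integral_RL_kernel_same:
  assumes "\<xi> \<noteq> \<eta>"
  shows "(\<integral>\<^sup>+x. ennreal (RL_kernel s (x - \<xi>) * RL_kernel s (x - \<eta>)) \<partial>lborel)
     = ennreal (\<bar>\<xi> - \<eta>\<bar> powr (2 * s - 1)) * (\<integral>\<^sup>+w. ennreal (RL_kernel s (1 + w) * RL_kernel s w) \<partial>lborel)"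
  using assms nn_integral_RL_kernel_same_ordered[of \<xi> \<eta> s] nn_integral_RL_kernel_same_ordered[of \<eta> \<xi> s]
  by (cases "\<xi> < \<eta>") (auto simp: mult.commute abs_minus_commute)

lemma RL_kernel_opposite_const_finite:
  assumes "0 < s"
  shows "(\<integral>\<^sup>+w. ennreal (RL_kernel s w * RL_kernel s (1 - w)) \<partial>lborel) < \<infinity>"
proof -
  have "(\<integral>\<^sup>+w. ennreal (RL_kernel s w * RL_kernel s (1 - w)) \<partial>lborel) 
    = (\<integral>\<^sup>+w. ennreal (w powr (s - 1) * (1 - w) powr (s - 1)) * indicator {0..1} w \<partial>lborel)"
    by (intro nn_integral_cong) (auto simp: RL_kernel_def indicator_def)
  also have "\<dots> = ennreal (Beta s s)"
    by (intro nn_integral_has_integral_lebesgue' has_integral_Beta_real assms) auto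
  finally show ?thesis by simp
qed

text \<open>
  Near \<open>0\<close> the integrand behaves like \<open>w powr (s - 1)\<close>, near infinity like
  \<open>w powr (2 * s - 2)\<close>; integrability of the tail is where \<open>s < 1/2\<close> enters.
\<close>

lemma RL_kernel_same_const_finite:
  assumes "0 < s" "s < 1/2"
  shows "(\<integral>\<^sup>+w. ennreal (RL_kernel s (1 + w) * RL_kernel s w) \<partial>lborel) < \<infinity>"
proof -
  have le: "ennreal (RL_kernel s (1 + w) * RL_kernel s w) \<le>
     ennreal (w powr (s - 1)) * indicator {0..1} w + ennreal (w powr (2 * s - 2)) * indicator {1..} w" for w
  proof -
    have "(1 + w) powr (s - 1) \<le> 1" if "0 < w"
      using that assms powr_mono2'[of "s - 1" 1 "1 + w"] by simp
    moreover have "(1 + w) powr (s - 1) * w powr (s - 1) \<le> w powr (2 * s - 2)" if "0 < w"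
    proof -
      have "(1 + w) powr (s - 1) \<le> w powr (s - 1)" 
        using that assms by (intro powr_mono2') auto
      then have "(1 + w) powr (s - 1) * w powr (s - 1) \<le> w powr (s - 1) * w powr (s - 1)"
        by (intro mult_right_mono) auto
      also have "\<dots> = w powr (2 * s - 2)" by (simp flip: powr_add)
      finally show ?thesis .
    qed
    ultimately have "0 < w \<Longrightarrow> w \<le> 1 \<Longrightarrow> ?thesis" "1 < w \<Longrightarrow> ?thesis"
      by (auto simp: RL_kernel_def intro!: ennreal_leI mult_left_le_one_le add_increasing2)
    then show ?thesis
      by (cases "w \<le> 0"; cases "w \<le> 1") (auto simp: RL_kernel_def)
  qed
  have "(\<integral>\<^sup>+w. ennreal (RL_kernel s (1 + w) * RL_kernel s w) \<partial>lborel) \<le> 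
    (\<integral>\<^sup>+w. ennreal (w powr (s - 1)) * indicator {0..1} w \<partial>lborel) + 
    (\<integral>\<^sup>+w. ennreal (w powr (2 * s - 2)) * indicator {1..} w \<partial>lborel)"
    using le by (subst nn_integral_add[symmetric]) (auto intro!: nn_integral_mono)
  also have "(\<integral>\<^sup>+w. ennreal (w powr (s - 1)) * indicator {0..1} w \<partial>lborel) = ennreal (1 powr (s - 1 + 1) / (s - 1 + 1))"
    using assms by (intro nn_integral_powr_from_0) auto
  also have "(\<integral>\<^sup>+w. ennreal (w powr (2 * s - 2)) * indicator {1..} w \<partial>lborel) = ennreal (-(1 powr (2 * s - 2 + 1)) / (2 * s - 2 + 1))"
    using assms by (intro nn_integral_has_integral_lebesgue' has_integral_powr_to_inf) auto
  finally show ?thesis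
    by (auto simp: top_unique less_top[symmetric])
qed

lemma RL_kernel_same_const_pos: "0 < (\<integral>\<^sup>+w. ennreal (RL_kernel s (1 + w) * RL_kernel s w) \<partial>lborel)"
proof -
  have "\<not> (AE w in lborel. ennreal (RL_kernel s (1 + w) * RL_kernel s w) = 0)"
  proof
    assume "AE w in lborel. ennreal (RL_kernel s (1 + w) * RL_kernel s w) = 0"
    then have "AE w in lborel. w \<notin> {0<..<1::real}"
      by eventually_elim (auto simp: RL_kernel_def ennreal_eq_0_iff simp flip: not_less)
    then have "emeasure lborel {0<..<1::real} = 0"
      using AE_iff_null_sets[of "{0<..<1::real}" lborel] by (intro null_setsD1) simp
    moreover have "emeasure lborel {0<..<1::real} = 1" by simp
    ultimately show False by (metis zero_neq_one)
  qed
  then have "(\<integral>\<^sup>+w. ennreal (RL_kernel s (1 + w) * RL_kernel s w) \<partial>lborel) \<noteq> 0"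
    by (subst nn_integral_0_iff_AE) auto
  then show ?thesis by (simp add: zero_less_iff_neq_zero)
qed

section \<open>Fractional integrals and positivity of the pairing\<close>

lemma cnj_borel_measurable [measurable]: "cnj \<in> borel_measurable borel"
  by (intro borel_measurable_continuous_onI continuous_intros)

text \<open>
  Fubini's theorem for the triple integral over \<open>(x, \<xi>, \<eta>)\<close>: the pairing of two
  integral operators is the sesquilinear form whose kernel is the composition of their kernels.
  Absolute integrability is required only after the integration over \<open>x\<close>, in the form
  in which homogeneity of the kernels makes it checkable.
\<close>

lemma integral_pairing_of_kernel_operators:
  fixes f g :: "real \<Rightarrow> complex" and k l :: "real \<Rightarrow> real \<Rightarrow> real"
  assumes [measurable]: "f \<in> borel_measurable borel" "g \<in> borel_measurable borel"
    and [measurable]: "case_prod k \<in> borel_measurable (borel \<Otimes>\<^sub>M borel)" 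
      "case_prod l \<in> borel_measurable (borel \<Otimes>\<^sub>M borel)"
    and nonneg: "\<And>x \<xi>. 0 \<le> k x \<xi>" "\<And>x \<xi>. 0 \<le> l x \<xi>"
    and fin: "(\<integral>\<^sup>+ \<xi>. \<integral>\<^sup>+ \<eta>. ennreal (cmod (f \<xi>) * cmod (g \<eta>)) *
         (\<integral>\<^sup>+ x. ennreal (k x \<xi> * l x \<eta>) \<partial>lborel) \<partial>lborel \<partial>lborel) < \<infinity>"
  defines "A \<equiv> \<lambda>x. (LINT \<xi>|lborel. k x \<xi> *\<^sub>R f \<xi>) * cnj (LINT \<eta>|lborel. l x \<eta> *\<^sub>R g \<eta>)"
    and "M \<equiv> \<lambda>p. (LINT x|lborel. k x (fst p) * l x (snd p)) *\<^sub>R (f (fst p) * cnj (g (snd p)))"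
  shows "integrable (lborel \<Otimes>\<^sub>M lborel) M"
    "(LINT x|lborel. A x) = (LINT p|(lborel \<Otimes>\<^sub>M lborel). M p)"
proof -
  define J where "J = (\<lambda>x p. (k x (fst p) *\<^sub>R f (fst p)) * cnj (l x (snd p) *\<^sub>R g (snd p)))"
  interpret LLL: pair_sigma_finite "lborel :: real measure" "lborel \<Otimes>\<^sub>M (lborel :: real measure)"
    by (intro pair_sigma_finite.intro sigma_finite_lborel sigma_finite_pair_measure)
  have J_meas [measurable]: "case_prod J \<in> borel_measurable (lborel \<Otimes>\<^sub>M (lborel \<Otimes>\<^sub>M lborel))"
    unfolding J_def by measurable
  have normJ: "ennreal (cmod (J x p)) = ennreal (cmod (f (fst p)) * cmod (g (snd p))) * ennreal (k x (fst p) * l x (snd p))" for x p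
    using nonneg by (subst ennreal_mult'[symmetric]) (simp_all add: J_def norm_mult mult_ac)
  have int: "integrable (lborel \<Otimes>\<^sub>M (lborel \<Otimes>\<^sub>M lborel)) (case_prod J)"
  proof (rule integrableI_bounded)
    have "(\<integral>\<^sup>+ z. ennreal (norm (case_prod J z)) \<partial>(lborel \<Otimes>\<^sub>M (lborel \<Otimes>\<^sub>M lborel)))
        = (\<integral>\<^sup>+ p. \<integral>\<^sup>+ x. ennreal (cmod (J x p)) \<partial>lborel \<partial>(lborel \<Otimes>\<^sub>M lborel))"
      by (subst LLL.nn_integral_snd[symmetric]) auto
    also have "\<dots> = (\<integral>\<^sup>+ p. ennreal (cmod (f (fst p)) * cmod (g (snd p))) *
         (\<integral>\<^sup>+ x. ennreal (k x (fst p) * l x (snd p)) \<partial>lborel) \<partial>(lborel \<Otimes>\<^sub>M lborel))"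
      unfolding normJ by (intro nn_integral_cong nn_integral_cmult) simp
    also have "\<dots> = (\<integral>\<^sup>+ \<xi>. \<integral>\<^sup>+ \<eta>. ennreal (cmod (f \<xi>) * cmod (g \<eta>)) *
         (\<integral>\<^sup>+ x. ennreal (k x \<xi> * l x \<eta>) \<partial>lborel) \<partial>lborel \<partial>lborel)"
      by (subst lborel.nn_integral_fst[symmetric]) simp_all
    finally show "(\<integral>\<^sup>+ z. ennreal (norm (case_prod J z)) \<partial>(lborel \<Otimes>\<^sub>M (lborel \<Otimes>\<^sub>M lborel))) < \<infinity>"
      using fin by simp
  qed simp
  have A: "AE x in lborel. (LINT p|(lborel \<Otimes>\<^sub>M lborel). J x p) = A x"
    using LLL.AE_integrable_fst'[OF int]
  proof eventually_elim
    case (elim x)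
    then have *: "integrable (lborel \<Otimes>\<^sub>M lborel) (J x)" by simp
    have "(LINT p|(lborel \<Otimes>\<^sub>M lborel). J x p) = (LINT \<xi>|lborel. LINT \<eta>|lborel. J x (\<xi>, \<eta>))"
      by (rule lborel_pair.integral_fst'[OF *, symmetric])
    also have "\<dots> = A x"
      by (simp only: J_def A_def fst_conv snd_conv integral_mult_right_zero integral_mult_left_zero Bochner_Integration.integral_cnj)
    finally show ?case .
  qed
  have M: "(LINT x|lborel. J x p) = M p" for p
  proof -
    have "J x p = (k x (fst p) * l x (snd p)) *\<^sub>R (f (fst p) * cnj (g (snd p)))" for x
      by (simp add: J_def)
    then show ?thesis
      by (simp only: M_def scaleR_conv_of_real integral_mult_left_zero integral_complex_of_real)
  qed
  have [measurable]: "A \<in> borel_measurable lborel"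
    unfolding A_def by measurable
  show "integrable (lborel \<Otimes>\<^sub>M lborel) M"
    using LLL.integrable_snd[OF int] by (simp add: M)
  have "(LINT x|lborel. A x) = (LINT x|lborel. LINT p|(lborel \<Otimes>\<^sub>M lborel). J x p)"
    by (rule integral_cong_AE) (use A in \<open>auto elim: AE_mp\<close>)
  also have "\<dots> = (LINT p|(lborel \<Otimes>\<^sub>M lborel). LINT x|lborel. J x p)"
    using LLL.Fubini_integral[OF int] by simp
  finally show "(LINT x|lborel. A x) = (LINT p|(lborel \<Otimes>\<^sub>M lborel). M p)"
    by (simp add: M)
qed

definition RL_integral :: "real \<Rightarrow> (real \<Rightarrow> complex) \<Rightarrow> real \<Rightarrow> complex" where
  "RL_integral s f x = (LINT \<xi>|lborel. RL_kernel s (x - \<xi>) *\<^sub>R f \<xi>)"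

definition RL_integral_right :: "real \<Rightarrow> (real \<Rightarrow> complex) \<Rightarrow> real \<Rightarrow> complex" where
  "RL_integral_right s f x = (LINT \<xi>|lborel. RL_kernel s (\<xi> - x) *\<^sub>R f \<xi>)"

text \<open>
  Absolute integrability for bounded functions supported in a bounded interval: the exponent
  \<open>2 * s - 1\<close> exceeds \<open>-1\<close>.  The bound on the kernel is assumed only off the diagonal,
  a null set, because the composed kernel may be infinite there.
\<close>

lemma nn_integral_bounded_kernel_finite:
  fixes f g :: "real \<Rightarrow> complex"
  assumes "0 < s" "a < b" "0 \<le> C" "0 \<le> D"
    and f: "\<And>x. cmod (f x) \<le> C * indicator {a<..<b} x" and g: "\<And>x. cmod (g x) \<le> D * indicator {a<..<b} x"
    and k: "\<And>\<xi> \<eta>. \<xi> \<noteq> \<eta> \<Longrightarrow> k \<xi> \<eta> \<le> ennreal (\<bar>\<xi> - \<eta>\<bar> powr (2 * s - 1)) * c" and c: "c < \<infinity>"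
  shows "(\<integral>\<^sup>+ \<xi>. \<integral>\<^sup>+ \<eta>. ennreal (cmod (f \<xi>) * cmod (g \<eta>)) * k \<xi> \<eta> \<partial>lborel \<partial>lborel) < \<infinity>"
proof -
  define E where "E = ennreal (2 * (b - a) powr (2 * s - 1 + 1) / (2 * s - 1 + 1))"
  define m where "m = ennreal C * ennreal D * c"
  have inner: "(\<integral>\<^sup>+ \<eta>. ennreal (cmod (f \<xi>) * cmod (g \<eta>)) * k \<xi> \<eta> \<partial>lborel)
     \<le> m * E * indicator {a<..<b} \<xi>" for \<xi>
  proof (cases "\<xi> \<in> {a<..<b}")
    case True
    have "(\<integral>\<^sup>+ \<eta>. ennreal (cmod (f \<xi>) * cmod (g \<eta>)) * k \<xi> \<eta> \<partial>lborel)
       \<le> (\<integral>\<^sup>+ \<eta>. m * (ennreal (\<bar>\<xi> - \<eta>\<bar> powr (2 * s - 1)) * indicator {a<..<b} \<eta>) \<partial>lborel)"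
    proof (rule nn_integral_mono_AE)
      show "AE \<eta> in lborel. ennreal (cmod (f \<xi>) * cmod (g \<eta>)) * k \<xi> \<eta>
        \<le> m * (ennreal (\<bar>\<xi> - \<eta>\<bar> powr (2 * s - 1)) * indicator {a<..<b} \<eta>)"
        using AE_lborel_singleton[of \<xi>]
      proof eventually_elim
        case (elim \<eta>)
        have fg: "cmod (f \<xi>) * cmod (g \<eta>) \<le> C * D * indicator {a<..<b} \<eta>"
          using mult_mono[OF f[of \<xi>] g[of \<eta>]] assms True by (simp add: mult_ac)
        have "ennreal (cmod (f \<xi>) * cmod (g \<eta>)) * k \<xi> \<eta>
           \<le> ennreal (C * D * indicator {a<..<b} \<eta>) * (ennreal (\<bar>\<xi> - \<eta>\<bar> powr (2 * s - 1)) * c)"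
          using elim by (intro mult_mono ennreal_leI fg k) auto
        also have "\<dots> = m * (ennreal (\<bar>\<xi> - \<eta>\<bar> powr (2 * s - 1)) * indicator {a<..<b} \<eta>)"
          using assms by (auto simp: m_def indicator_def ennreal_mult' mult_ac)
        finally show ?case .
      qed
    qed
    also have "\<dots> = m * (\<integral>\<^sup>+ \<eta>. ennreal (\<bar>\<xi> - \<eta>\<bar> powr (2 * s - 1)) * indicator {a<..<b} \<eta> \<partial>lborel)"
      by (rule nn_integral_cmult) simp
    also have "\<dots> \<le> m * E"
      unfolding E_def using assms True by (intro mult_left_mono nn_integral_abs_powr_le) auto
    finally show ?thesis using True by simp
  next
    case False
    then have "f \<xi> = 0" using f[of \<xi>] by simp
    then show ?thesis by simp
  qed
  have "(\<integral>\<^sup>+ \<xi>. \<integral>\<^sup>+ \<eta>. ennreal (cmod (f \<xi>) * cmod (g \<eta>)) * k \<xi> \<eta> \<partial>lborel \<partial>lborel)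
     \<le> (\<integral>\<^sup>+ \<xi>. m * E * indicator {a<..<b} \<xi> \<partial>lborel)"
    by (intro nn_integral_mono inner)
  also have "\<dots> = m * E * ennreal (b - a)"
    using assms by (subst nn_integral_cmult_indicator) auto
  also have "\<dots> < \<infinity>"
    using c by (auto simp: m_def E_def ennreal_mult_less_top)
  finally show ?thesis .
qed

lemma
  fixes f g :: "real \<Rightarrow> complex"
  assumes "0 < s" "a < b" "0 \<le> C" "0 \<le> D"
    and [measurable]: "f \<in> borel_measurable borel" "g \<in> borel_measurable borel"
    and f: "\<And>x. cmod (f x) \<le> C * indicator {a<..<b} x" and g: "\<And>x. cmod (g x) \<le> D * indicator {a<..<b} x"
  defines "M \<equiv> \<lambda>p. enn2real (\<integral>\<^sup>+w. ennreal (RL_kernel s w * RL_kernel s (1 - w)) \<partial>lborel) *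
      RL_kernel (2 * s) (snd p - fst p)"
  shows integrable_RL_integral_opposite_kernel: 
      "integrable (lborel \<Otimes>\<^sub>M lborel) (\<lambda>p. M p *\<^sub>R (f (fst p) * cnj (g (snd p))))"
    and integral_RL_integral_opposite: "(LINT x|lborel. RL_integral s f x * cnj (RL_integral_right s g x))
       = (LINT p|(lborel \<Otimes>\<^sub>M lborel). M p *\<^sub>R (f (fst p) * cnj (g (snd p))))"
proof -
  have le: "(\<integral>\<^sup>+x. ennreal (RL_kernel s (x - \<xi>) * RL_kernel s (\<eta> - x)) \<partial>lborel)
      \<le> ennreal (\<bar>\<xi> - \<eta>\<bar> powr (2 * s - 1)) * (\<integral>\<^sup>+w. ennreal (RL_kernel s w * RL_kernel s (1 - w)) \<partial>lborel)" for \<xi> \<eta>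
  proof -
    have "RL_kernel (2 * s) (\<eta> - \<xi>) \<le> \<bar>\<xi> - \<eta>\<bar> powr (2 * s - 1)"
      using RL_kernel_le_abs[of "2 * s" "\<eta> - \<xi>"] by (simp only: abs_minus_commute)
    from mult_right_mono[OF ennreal_leI[OF this]] show ?thesis
      by (subst nn_integral_RL_kernel_opposite) simp
  qed
  have fin: "(\<integral>\<^sup>+ \<xi>. \<integral>\<^sup>+ \<eta>. ennreal (cmod (f \<xi>) * cmod (g \<eta>)) *
         (\<integral>\<^sup>+ x. ennreal (RL_kernel s (x - \<xi>) * RL_kernel s (\<eta> - x)) \<partial>lborel) \<partial>lborel \<partial>lborel) < \<infinity>"
    by (rule nn_integral_bounded_kernel_finite[OF assms(1-4) f g le RL_kernel_opposite_const_finite[OF assms(1)]])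
  have M: "(LINT x|lborel. RL_kernel s (x - fst p) * RL_kernel s (snd p - x)) = M p" for p
    by (subst integral_eq_nn_integral)
       (simp_all only: nn_integral_RL_kernel_opposite, auto simp: M_def enn2real_mult)
  have [measurable]: "case_prod (\<lambda>x \<xi>. RL_kernel s (x - \<xi>)) \<in> borel_measurable (borel \<Otimes>\<^sub>M borel)"
     "case_prod (\<lambda>x \<xi>. RL_kernel s (\<xi> - x)) \<in> borel_measurable (borel \<Otimes>\<^sub>M borel)"
    by measurable
  note * = integral_pairing_of_kernel_operators[where k = "\<lambda>x \<xi>. RL_kernel s (x - \<xi>)" and l = "\<lambda>x \<xi>. RL_kernel s (\<xi> - x)", 
      OF assms(5,6) \<open>case_prod (\<lambda>x \<xi>. RL_kernel s (x - \<xi>)) \<in> _\<close>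
        \<open>case_prod (\<lambda>x \<xi>. RL_kernel s (\<xi> - x)) \<in> _\<close> RL_kernel_nonneg RL_kernel_nonneg fin, unfolded M]
  show "integrable (lborel \<Otimes>\<^sub>M lborel) (\<lambda>p. M p *\<^sub>R (f (fst p) * cnj (g (snd p))))"
    "(LINT x|lborel. RL_integral s f x * cnj (RL_integral_right s g x))
       = (LINT p|(lborel \<Otimes>\<^sub>M lborel). M p *\<^sub>R (f (fst p) * cnj (g (snd p))))"
    unfolding RL_integral_def RL_integral_right_def by (fact *)+
qed

lemma AE_off_diagonal: "AE p in lborel \<Otimes>\<^sub>M lborel. fst p \<noteq> (snd p :: real)"
proof (rule lborel_pair.AE_pair_measure)
  have "{p \<in> space (borel \<Otimes>\<^sub>M borel). fst p \<noteq> (snd p :: real)} \<in> sets (borel \<Otimes>\<^sub>M borel)"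
    by measurable
  then show "{p \<in> space (lborel \<Otimes>\<^sub>M lborel). fst p \<noteq> (snd p :: real)} \<in> sets (lborel \<Otimes>\<^sub>M lborel)"
    by (simp add: space_pair_measure cong: sets_pair_measure_cong)
  show "AE x in lborel. AE y in lborel. fst (x, y) \<noteq> (snd (x, y) :: real)"
  proof (rule AE_I2)
    fix x :: real
    show "AE y in lborel. fst (x, y) \<noteq> snd (x, y)"
      using AE_lborel_singleton[of x] by eventually_elim auto
  qed
qed

text \<open>
  Positivity of the fractional pairing.  Adding the complex conjugate of the pairing symmetrises its
  kernel \<open>(\<eta> - \<xi>)^(2s-1)\<close> to \<open>|\<xi> - \<eta>|^(2s-1)\<close>, which up to a
  positive constant is the kernel of the squared norm of \<open>RL_integral s f\<close>.
\<close>

lemma Re_RL_integral_opposite_nonneg: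
  fixes f :: "real \<Rightarrow> complex"
  assumes s: "0 < s" "s < 1/2" and "a < b" "0 \<le> C" 
    and [measurable]: "f \<in> borel_measurable borel"
    and f: "\<And>x. cmod (f x) \<le> C * indicator {a<..<b} x"
  shows "0 \<le> Re (LINT x|lborel. RL_integral s f x * cnj (RL_integral_right s f x))"
proof -
  define B where "B = enn2real (\<integral>\<^sup>+w. ennreal (RL_kernel s w * RL_kernel s (1 - w)) \<partial>lborel)"
  define c where "c = (\<integral>\<^sup>+w. ennreal (RL_kernel s (1 + w) * RL_kernel s w) \<partial>lborel)"
  define h where "h = (\<lambda>p. f (fst p) * cnj (f (snd p)))"
  define M where "M = (\<lambda>p :: real \<times> real. B * RL_kernel (2 * s) (snd p - fst p))"
  define Z where "Z = (LINT p|(lborel \<Otimes>\<^sub>M lborel). M p *\<^sub>R h p)"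
  have c: "0 < c" "c < \<infinity>"
    unfolding c_def using RL_kernel_same_const_pos RL_kernel_same_const_finite[OF s] by auto
  then have C: "0 < enn2real c" by (simp add: enn2real_positive_iff)
  have Z: "(LINT x|lborel. RL_integral s f x * cnj (RL_integral_right s f x)) = Z"
    unfolding Z_def M_def h_def B_def using assms by (intro integral_RL_integral_opposite[of s a b C C]) auto
  have Z_int: "integrable (lborel \<Otimes>\<^sub>M lborel) (\<lambda>p. M p *\<^sub>R h p)"
    unfolding Z_def M_def h_def B_def using assms by (intro integrable_RL_integral_opposite_kernel[of s a b C C]) auto
  have fin: "(\<integral>\<^sup>+ \<xi>. \<integral>\<^sup>+ \<eta>. ennreal (cmod (f \<xi>) * cmod (f \<eta>)) *
         (\<integral>\<^sup>+ x. ennreal (RL_kernel s (x - \<xi>) * RL_kernel s (x - \<eta>)) \<partial>lborel) \<partial>lborel \<partial>lborel) < \<infinity>"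
    by (rule nn_integral_bounded_kernel_finite[OF s(1) assms(3,4,4) f f _ c(2)])
       (simp add: c_def nn_integral_RL_kernel_same del: ennreal_mult')
  define S where "S = (\<lambda>p. LINT x|lborel. RL_kernel s (x - fst p) * RL_kernel s (x - snd p))"
  have S: "S p = enn2real c * \<bar>fst p - snd p\<bar> powr (2 * s - 1)" if "fst p \<noteq> snd p" for p
    unfolding S_def
    by (subst integral_eq_nn_integral)
       (simp_all only: nn_integral_RL_kernel_same[OF that], auto simp: c_def enn2real_mult)
  have [measurable]: "case_prod (\<lambda>x \<xi>. RL_kernel s (x - \<xi>)) \<in> borel_measurable (borel \<Otimes>\<^sub>M borel)"
    by measurable
  note same = integral_pairing_of_kernel_operators[where k = "\<lambda>x \<xi>. RL_kernel s (x - \<xi>)" and l = "\<lambda>x \<xi>. RL_kernel s (x - \<xi>)" 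
      and f = f and g = f, OF _ _ _ _ _ _ fin, simplified, folded RL_integral_def]
  have "cnj Z = (LINT p|(lborel \<Otimes>\<^sub>M lborel). cnj (M p *\<^sub>R h p))"
    by (simp only: Z_def Bochner_Integration.integral_cnj)
  also have "\<dots> = (LINT p|(lborel \<Otimes>\<^sub>M lborel). (case p of (x, y) \<Rightarrow> cnj (M (y, x) *\<^sub>R h (y, x))))"
    by (rule lborel_pair.integral_product_swap[symmetric])
       (rule borel_measurable_integrable[OF integrable_cnj[OF Z_int]])
  finally have "Z + cnj Z = Z + (LINT p|(lborel \<Otimes>\<^sub>M lborel). (case p of (x, y) \<Rightarrow> cnj (M (y, x) *\<^sub>R h (y, x))))"
    by simp
  also have "\<dots> = (LINT p|(lborel \<Otimes>\<^sub>M lborel). M p *\<^sub>R h p + (case p of (x, y) \<Rightarrow> cnj (M (y, x) *\<^sub>R h (y, x))))"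
    unfolding Z_def
    by (rule Bochner_Integration.integral_add[symmetric, OF Z_int])
       (rule lborel_pair.integrable_product_swap[OF integrable_cnj[OF Z_int]])
  also have "\<dots> = (LINT p|(lborel \<Otimes>\<^sub>M lborel). (B / enn2real c) *\<^sub>R (S p *\<^sub>R h p))"
  proof (rule integral_cong_AE)
    show "AE p in lborel \<Otimes>\<^sub>M lborel. M p *\<^sub>R h p + (case p of (x, y) \<Rightarrow> cnj (M (y, x) *\<^sub>R h (y, x)))
        = (B / enn2real c) *\<^sub>R (S p *\<^sub>R h p)"
      using AE_off_diagonal
    proof eventually_elim
      case (elim p)
      then show ?case using C
        by (cases p; cases "fst p < snd p") (auto simp: S M_def h_def RL_kernel_def)
    qed
  qed (unfold M_def h_def S_def, measurable)
  also have "\<dots> = (B / enn2real c) *\<^sub>R (LINT x|lborel. RL_integral s f x * cnj (RL_integral s f x))"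
    unfolding same(2) S_def h_def by (simp only: integral_scaleR_right)
  also have "(LINT x|lborel. RL_integral s f x * cnj (RL_integral s f x)) 
      = complex_of_real (LINT x|lborel. (cmod (RL_integral s f x))\<^sup>2)"
    by (simp only: complex_norm_square[symmetric] integral_complex_of_real)
  finally have "Z + cnj Z = complex_of_real (B / enn2real c * (LINT x|lborel. (cmod (RL_integral s f x))\<^sup>2))"
    by (simp add: scaleR_conv_of_real)
  then have "Re (Z + cnj Z) = B / enn2real c * (LINT x|lborel. (cmod (RL_integral s f x))\<^sup>2)"
    by (simp only: Re_complex_of_real)
  moreover have "0 \<le> \<dots>"
    using C by (intro mult_nonneg_nonneg divide_nonneg_pos integral_nonneg) (auto simp: B_def)
  ultimately show ?thesis unfolding Z by simp
qed

section \<open>Riemann--Liouville derivatives of polynomials\<close>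

definition poly_zero_ext :: "real \<Rightarrow> real \<Rightarrow> complex poly \<Rightarrow> real \<Rightarrow> complex" where
  "poly_zero_ext a b p x = indicator {a<..<b} x *\<^sub>R poly p (complex_of_real x)"

lemma continuous_on_poly_of_real [continuous_intros]:
  "continuous_on S (\<lambda>x. poly p (complex_of_real x))"
  by (intro continuous_on_compose2[OF continuous_on_poly[OF continuous_on_id]] continuous_intros) auto

lemma poly_of_real_measurable [measurable]: "(\<lambda>x. poly p (complex_of_real x)) \<in> borel_measurable borel"
  by (intro borel_measurable_continuous_onI continuous_intros)

lemma poly_zero_ext_measurable [measurable]: "poly_zero_ext a b p \<in> borel_measurable borel"
  unfolding poly_zero_ext_def by measurable

lemma poly_of_real_bounded:
  obtains C where "0 \<le> C" "\<And>x. x \<in> {a..b} \<Longrightarrow> cmod (poly p (complex_of_real x)) \<le> C"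
proof -
  have "bounded ((\<lambda>x. poly p (complex_of_real x)) ` {a..b})"
    by (intro compact_imp_bounded compact_continuous_image continuous_intros) auto
  then obtain C where "\<forall>x\<in>{a..b}. cmod (poly p (complex_of_real x)) \<le> C"
    by (auto simp: bounded_iff)
  then have "cmod (poly p (complex_of_real x)) \<le> max C 0" if "x \<in> {a..b}" for x
    using that by (auto simp: le_max_iff_disj)
  then show ?thesis by (intro that[of "max C 0"]) auto
qed

lemma poly_zero_ext_bounded:
  obtains C where "0 \<le> C" "\<And>x. cmod (poly_zero_ext a b p x) \<le> C * indicator {a<..<b} x"
proof -
  obtain C where "0 \<le> C" "\<And>x. x \<in> {a..b} \<Longrightarrow> cmod (poly p (complex_of_real x)) \<le> C"
    using poly_of_real_bounded[of a b p] by blast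
  then show ?thesis by (intro that[of C]) (auto simp: poly_zero_ext_def indicator_def)
qed

lemma integrable_RL_kernel_poly_zero_ext:
  assumes "0 < s" "x \<in> {a..b}"
  shows "integrable lborel (\<lambda>\<xi>. RL_kernel s (x - \<xi>) *\<^sub>R poly_zero_ext a b p \<xi>)"
proof (rule integrableI_bounded)
  obtain C where C: "0 \<le> C" "\<And>x. cmod (poly_zero_ext a b p x) \<le> C * indicator {a<..<b} x"
    using poly_zero_ext_bounded[of a b p] by blast
  have "(\<integral>\<^sup>+ \<xi>. ennreal (norm (RL_kernel s (x - \<xi>) *\<^sub>R poly_zero_ext a b p \<xi>)) \<partial>lborel)
     \<le> (\<integral>\<^sup>+ \<xi>. ennreal C * (ennreal (\<bar>x - \<xi>\<bar> powr (s - 1)) * indicator {a<..<b} \<xi>) \<partial>lborel)"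
  proof (rule nn_integral_mono)
    fix \<xi>
    have "norm (RL_kernel s (x - \<xi>) *\<^sub>R poly_zero_ext a b p \<xi>) \<le> \<bar>x - \<xi>\<bar> powr (s - 1) * (C * indicator {a<..<b} \<xi>)"
      unfolding norm_scaleR using C by (intro mult_mono) (auto simp: RL_kernel_le_abs)
    also have "\<dots> = C * (\<bar>x - \<xi>\<bar> powr (s - 1)) * indicator {a<..<b} \<xi>" by simp
    finally have "ennreal (norm (RL_kernel s (x - \<xi>) *\<^sub>R poly_zero_ext a b p \<xi>)) 
      \<le> ennreal (C * (\<bar>x - \<xi>\<bar> powr (s - 1)) * indicator {a<..<b} \<xi>)" by (rule ennreal_leI)
    also have "\<dots> = ennreal C * (ennreal (\<bar>x - \<xi>\<bar> powr (s - 1)) * indicator {a<..<b} \<xi>)"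
      using C(1) by (auto simp: ennreal_mult' indicator_def)
    finally show "ennreal (norm (RL_kernel s (x - \<xi>) *\<^sub>R poly_zero_ext a b p \<xi>)) 
      \<le> ennreal C * (ennreal (\<bar>x - \<xi>\<bar> powr (s - 1)) * indicator {a<..<b} \<xi>)" .
  qed
  also have "\<dots> = ennreal C * (\<integral>\<^sup>+ \<xi>. ennreal (\<bar>x - \<xi>\<bar> powr (s - 1)) * indicator {a<..<b} \<xi> \<partial>lborel)"
    by (rule nn_integral_cmult) simp
  also have "\<dots> \<le> ennreal C * ennreal (2 * (b - a) powr (s - 1 + 1) / (s - 1 + 1))"
    using assms by (intro mult_left_mono nn_integral_abs_powr_le) auto
  also have "\<dots> < \<infinity>" by (simp add: ennreal_mult_less_top)
  finally show "(\<integral>\<^sup>+ \<xi>. ennreal (norm (RL_kernel s (x - \<xi>) *\<^sub>R poly_zero_ext a b p \<xi>)) \<partial>lborel) < \<infinity>" .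
qed simp

text \<open>
  The substitution \<open>\<xi> = a + (x - a) w\<close> turns the integral into the Beta integral.
\<close>

lemma RL_integral_monomial:
  assumes s: "0 < s" and x: "x \<in> {a<..<b}"
  shows "RL_integral s (poly_zero_ext a b ([:- complex_of_real a, 1:] ^ k)) x
     = complex_of_real (Beta (real k + 1) s * (x - a) powr (real k + s))"
proof -
  define t where "t = x - a"
  have t: "0 < t" using x by (simp add: t_def)
  define h where "h = (\<lambda>\<xi>. RL_kernel s (x - \<xi>) * (indicator {a<..<b} \<xi> * (\<xi> - a) ^ k))"
  have h0: "0 \<le> h \<xi>" for \<xi> by (auto simp: h_def indicator_def)
  have [measurable]: "h \<in> borel_measurable borel" unfolding h_def by measurable
  have h: "ennreal (h (a + t * w)) = ennreal (t powr (real k + s - 1)) *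
      (ennreal (w powr (real k + 1 - 1) * (1 - w) powr (s - 1)) * indicator {0..1} w)" for w
  proof (cases "w \<in> {0<..<1}")
    case True
    have "a + t * w \<in> {a<..<b}"
    proof -
      have "a + t * w < a + t * 1" using t True by (intro add_strict_left_mono mult_strict_left_mono) auto
      also have "a + t * 1 = x" by (simp add: t_def)
      finally show ?thesis using x t True by auto
    qed
    moreover have "x - (a + t * w) = t * (1 - w)" by (simp add: t_def algebra_simps)
    moreover have "RL_kernel s (1 - w) = (1 - w) powr (s - 1)" using True by (simp add: RL_kernel_def)
    ultimately have "h (a + t * w) = t powr (s - 1) * (1 - w) powr (s - 1) * (t powr real k * w powr real k)"
      using t True by (simp add: h_def RL_kernel_scale power_mult_distrib powr_realpow)
    also have "\<dots> = t powr (real k + s - 1) * (w powr (real k + 1 - 1) * (1 - w) powr (s - 1))"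
      by (simp add: powr_add powr_diff mult_ac)
    finally show ?thesis using True by (simp add: ennreal_mult')
  next
    case False
    have "h (a + t * w) = 0"
    proof (cases "w \<le> 0")
      case True
      then have "t * w \<le> 0" using t by (simp add: mult_nonneg_nonpos)
      then show ?thesis by (auto simp: h_def)
    next
      case False
      with \<open>w \<notin> _\<close> have "1 \<le> w" by auto
      then have "t * 1 \<le> t * w" using t by (intro mult_left_mono) auto
      then show ?thesis by (auto simp: h_def RL_kernel_def t_def)
    qed
    with False show ?thesis by (cases "w = 0 \<or> w = 1") (auto simp: indicator_def)
  qed
  have "(\<integral>\<^sup>+\<xi>. ennreal (h \<xi>) \<partial>lborel) = ennreal t * (\<integral>\<^sup>+w. ennreal (h (a + t * w)) \<partial>lborel)"
    using t by (subst nn_integral_real_affine[where c = t and t = a]) auto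
  also have "(\<integral>\<^sup>+w. ennreal (h (a + t * w)) \<partial>lborel) = ennreal (t powr (real k + s - 1)) *
      (\<integral>\<^sup>+w. ennreal (w powr (real k + 1 - 1) * (1 - w) powr (s - 1)) * indicator {0..1} w \<partial>lborel)"
    unfolding h by (rule nn_integral_cmult) simp
  also have "(\<integral>\<^sup>+w. ennreal (w powr (real k + 1 - 1) * (1 - w) powr (s - 1)) * indicator {0..1} w \<partial>lborel)
      = ennreal (Beta (real k + 1) s)"
    using s by (intro nn_integral_has_integral_lebesgue' has_integral_Beta_real) auto
  also have "ennreal t * (ennreal (t powr (real k + s - 1)) * ennreal (Beta (real k + 1) s))
      = ennreal (t * t powr (real k + s - 1)) * ennreal (Beta (real k + 1) s)"
    using t by (simp add: ennreal_mult' mult.assoc)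
  also have "\<dots> = ennreal (Beta (real k + 1) s * t powr (real k + s))"
    using t by (simp add: powr_mult_base ennreal_mult'' mult.commute)
  finally have nn: "(\<integral>\<^sup>+\<xi>. ennreal (h \<xi>) \<partial>lborel) = ennreal (Beta (real k + 1) s * t powr (real k + s))" .
  have "Beta (real k + 1) s \<ge> 0"
    using s by (auto simp: Beta_def intro!: divide_nonneg_nonneg mult_nonneg_nonneg Gamma_real_nonneg)
  then have "(LINT \<xi>|lborel. h \<xi>) = Beta (real k + 1) s * t powr (real k + s)"
    using h0 by (subst integral_eq_nn_integral) (auto simp: nn)
  moreover have "RL_kernel s (x - \<xi>) *\<^sub>R poly_zero_ext a b ([:- complex_of_real a, 1:] ^ k) \<xi> = complex_of_real (h \<xi>)" for \<xi>
    by (simp add: poly_zero_ext_def h_def scaleR_conv_of_real)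
  ultimately show ?thesis by (simp only: RL_integral_def integral_complex_of_real t_def)
qed

lemma poly_shift_expansion:
  fixes p :: "complex poly"
  obtains c n where "p = (\<Sum>k\<le>n. smult (c k) ([:- z, 1:] ^ k))" "c 0 = poly p z"
proof -
  define q where "q = pcompose p [:z, 1:]"
  have "p = pcompose q [:-z, 1:]"
    by (simp add: q_def pcompose_assoc[symmetric] pcompose_pCons)
  also have "\<dots> = (\<Sum>k\<le>degree q. smult (coeff q k) ([:- z, 1:] ^ k))"
    by (simp add: pcompose_altdef poly_altdef degree_map_poly coeff_map_poly)
  finally show ?thesis 
    by (intro that[of "coeff q" "degree q"]) (auto simp: q_def poly_pcompose simp flip: poly_0_coeff_0)
qed

lemma poly_zero_ext_sum: "poly_zero_ext a b (\<Sum>k\<in>A. f k) x = (\<Sum>k\<in>A. poly_zero_ext a b (f k) x)"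
  by (simp add: poly_zero_ext_def poly_sum scaleR_sum_right)

lemma poly_zero_ext_smult: "poly_zero_ext a b (smult c p) x = c * poly_zero_ext a b p x"
  by (simp add: poly_zero_ext_def)

lemma RL_integral_sum_poly_zero_ext:
  assumes "0 < s" "x \<in> {a..b}"
  shows "RL_integral s (poly_zero_ext a b (\<Sum>k\<in>A. smult (c k) (f k))) x = (\<Sum>k\<in>A. c k * RL_integral s (poly_zero_ext a b (f k)) x)"
  unfolding RL_integral_def poly_zero_ext_sum poly_zero_ext_smult scaleR_sum_right mult_scaleR_right[symmetric]
  by (subst Bochner_Integration.integral_sum) (use integrable_RL_kernel_poly_zero_ext[OF assms] in \<open>auto simp del: mult_scaleR_right\<close>)

text \<open>
  Differentiation commutes with fractional integration if there is no boundary term at \<open>a\<close>.  The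
  polynomial is expanded in powers of \<open>x - a\<close>, where both sides are explicit; for each power
  the claim is the recurrence \<open>(k + s) Beta(k + 1, s) = k Beta(k, s)\<close>.  This recurrence fails
  for \<open>k = 0\<close>, which is why the constant term has to vanish.
\<close>

lemma RL_integral_has_vector_derivative:
  assumes s: "0 < s" and x: "x \<in> {a<..<b}" and pa: "poly p (complex_of_real a) = 0"
  shows "(RL_integral s (poly_zero_ext a b p) has_vector_derivative RL_integral s (poly_zero_ext a b (pderiv p)) x) (at x)"
proof -
  let ?X = "[:- complex_of_real a, 1:]"
  obtain c n where p: "p = (\<Sum>k\<le>n. smult (c k) (?X ^ k))" and c0: "c 0 = 0"
    using poly_shift_expansion[of p "complex_of_real a"] pa by metis
  have p': "pderiv p = (\<Sum>k\<le>n. smult (c k * of_nat k) (?X ^ (k - 1)))"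
  proof -
    have "pderiv p = (\<Sum>k\<le>n. pderiv (smult (c k) (?X ^ k)))"
      unfolding p using higher_pderiv_sum[of 1] by simp
    then show ?thesis by (simp add: pderiv_smult pderiv_power pderiv_pCons mult_ac)
  qed
  have D: "((\<lambda>y. \<Sum>k\<le>n. c k * complex_of_real (Beta (real k + 1) s * (y - a) powr (real k + s))) 
     has_vector_derivative (\<Sum>k\<le>n. c k * complex_of_real (Beta (real k + 1) s * ((real k + s) * (x - a) powr (real k + s - 1))))) (at x)"
    using x by (intro has_vector_derivative_sum has_vector_derivative_mult_right has_vector_derivative_of_real) 
      (auto intro!: derivative_eq_intros)
  have "RL_integral s (poly_zero_ext a b (pderiv p)) x 
      = (\<Sum>k\<le>n. c k * complex_of_real (Beta (real k + 1) s * ((real k + s) * (x - a) powr (real k + s - 1))))"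
    unfolding p' using s x
  proof (subst RL_integral_sum_poly_zero_ext, simp, simp, intro sum.cong refl)
    fix k
    show "c k * of_nat k * RL_integral s (poly_zero_ext a b (?X ^ (k - 1))) x
       = c k * complex_of_real (Beta (real k + 1) s * ((real k + s) * (x - a) powr (real k + s - 1)))"
    proof (cases k)
      case 0
      then show ?thesis using c0 by simp
    next
      case (Suc m)
      have "(real k + s) * Beta (real k + 1) s = real k * Beta (real k) s"
        using s Suc by (intro Beta_plus1_left) auto
      from arg_cong[OF this, of "\<lambda>z. z * (x - a) powr (real m + s)"]
      have "real k * (Beta (real m + 1) s * (x - a) powr (real m + s)) 
          = Beta (real k + 1) s * ((real k + s) * (x - a) powr (real k + s - 1))"
        by (simp add: Suc algebra_simps)
      from arg_cong[OF this, of complex_of_real] show ?thesis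
        using s x by (simp add: Suc RL_integral_monomial)
    qed
  qed
  with D have D: "((\<lambda>y. \<Sum>k\<le>n. c k * complex_of_real (Beta (real k + 1) s * (y - a) powr (real k + s))) 
     has_vector_derivative RL_integral s (poly_zero_ext a b (pderiv p)) x) (at x)" by simp
  show ?thesis
    by (rule has_vector_derivative_transform_within_open[OF D, of "{a<..<b}"])
       (use x s in \<open>auto simp: p RL_integral_sum_poly_zero_ext RL_integral_monomial\<close>)
qed

text \<open>
  The reflection \<open>x \<mapsto> -x\<close> exchanges left and right, so the facts about right
  fractional integrals follow from those about left ones.
\<close>

lemma RL_integral_right_eq_reflect: "RL_integral_right s f x = RL_integral s (\<lambda>\<xi>. f (- \<xi>)) (- x)"
  unfolding RL_integral_def RL_integral_right_def
  by (subst lborel_integral_real_affine[where c = "-1" and t = 0]) (auto simp: add.commute)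

lemma poly_zero_ext_reflect: "poly_zero_ext a b p (- x) = poly_zero_ext (- b) (- a) (pcompose p [:0, -1:]) x"
  by (auto simp: poly_zero_ext_def poly_pcompose indicator_def)

lemma RL_integral_right_has_vector_derivative:
  assumes s: "0 < s" and x: "x \<in> {a<..<b}" and pb: "poly p (complex_of_real b) = 0"
  shows "(RL_integral_right s (poly_zero_ext a b p) has_vector_derivative RL_integral_right s (poly_zero_ext a b (pderiv p)) x) (at x)"
proof -
  define q where "q = pcompose p [:0, -1:]"
  have "(RL_integral s (poly_zero_ext (-b) (-a) q) has_vector_derivative RL_integral s (poly_zero_ext (-b) (-a) (pderiv q)) (-x)) (at (-x))"
    using s x pb by (intro RL_integral_has_vector_derivative) (auto simp: q_def poly_pcompose)
  then have "(RL_integral s (poly_zero_ext (-b) (-a) q) \<circ> uminus has_vector_derivative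
      (-1) *\<^sub>R RL_integral s (poly_zero_ext (-b) (-a) (pderiv q)) (-x)) (at x)"
    by (intro vector_diff_chain_at) (auto intro!: derivative_eq_intros)
  moreover have "RL_integral s (poly_zero_ext (-b) (-a) q) \<circ> uminus = RL_integral_right s (poly_zero_ext a b p)"
    by (auto simp: RL_integral_right_eq_reflect poly_zero_ext_reflect q_def fun_eq_iff)
  moreover have "(-1) *\<^sub>R RL_integral s (poly_zero_ext (-b) (-a) (pderiv q)) (-x) = RL_integral_right s (poly_zero_ext a b (pderiv p)) x"
  proof -
    have "poly_zero_ext (-b) (-a) (pderiv q) \<xi> = - poly_zero_ext a b (pderiv p) (- \<xi>)" for \<xi>
      unfolding poly_zero_ext_reflect q_def pderiv_pcompose by (simp add: poly_zero_ext_def pderiv_pCons)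
    then show ?thesis by (simp add: RL_integral_right_eq_reflect) (simp add: RL_integral_def)
  qed
  ultimately show ?thesis by simp
qed

lemma integral_lebesgue_on_eq_lborel:
  fixes f :: "real \<Rightarrow> complex"
  assumes "S \<in> sets borel" "g \<in> borel_measurable borel" "\<And>x. g x = indicator S x *\<^sub>R f x"
  shows "(LINT x|lebesgue_on S. f x) = (LINT x|lborel. g x)"
  using assms by (simp add: integral_restrict_space integral_completion flip: assms(3))

lemma RL_left_poly:
  assumes \<mu>: "\<mu> < 1" and x: "x \<in> {a<..<b}" and pa: "poly p (complex_of_real a) = 0"
    and u: "\<And>x. x \<in> {a<..<b} \<Longrightarrow> u x = poly p (complex_of_real x)"
  shows "RL_left a \<mu> u x = complex_of_real (1 / Gamma (1 - \<mu>)) * RL_integral (1 - \<mu>) (poly_zero_ext a b (pderiv p)) x"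
proof -
  have eq: "(LINT \<xi>|lebesgue_on {a<..<y}. u \<xi> / complex_of_real ((y - \<xi>) powr \<mu>)) = RL_integral (1 - \<mu>) (poly_zero_ext a b p) y"
    if "y \<in> {a<..<b}" for y
    unfolding RL_integral_def using that
    by (intro integral_lebesgue_on_eq_lborel)
       (auto simp: indicator_def poly_zero_ext_def RL_kernel_def u powr_minus scaleR_conv_of_real field_simps)
  have "((\<lambda>y. LINT \<xi>|lebesgue_on {a<..<y}. u \<xi> / complex_of_real ((y - \<xi>) powr \<mu>)) 
      has_vector_derivative RL_integral (1 - \<mu>) (poly_zero_ext a b (pderiv p)) x) (at x)"
    using \<mu> by (intro has_vector_derivative_transform_within_open[OF RL_integral_has_vector_derivative[OF _ x pa], of _ "{a<..<b}"])
      (use x eq in auto)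
  then show ?thesis unfolding RL_left_def by (simp add: vector_derivative_at)
qed

lemma RL_right_poly:
  assumes \<mu>: "\<mu> < 1" and x: "x \<in> {a<..<b}" and pb: "poly p (complex_of_real b) = 0"
    and u: "\<And>x. x \<in> {a<..<b} \<Longrightarrow> u x = poly p (complex_of_real x)"
  shows "RL_right b \<mu> u x = - complex_of_real (1 / Gamma (1 - \<mu>)) * RL_integral_right (1 - \<mu>) (poly_zero_ext a b (pderiv p)) x"
proof -
  have eq: "(LINT \<xi>|lebesgue_on {y<..<b}. u \<xi> / complex_of_real ((\<xi> - y) powr \<mu>)) = RL_integral_right (1 - \<mu>) (poly_zero_ext a b p) y"
    if "y \<in> {a<..<b}" for y
    unfolding RL_integral_right_def using that
    by (intro integral_lebesgue_on_eq_lborel)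
       (auto simp: indicator_def poly_zero_ext_def RL_kernel_def u powr_minus scaleR_conv_of_real field_simps)
  have "((\<lambda>y. LINT \<xi>|lebesgue_on {y<..<b}. u \<xi> / complex_of_real ((\<xi> - y) powr \<mu>)) 
      has_vector_derivative RL_integral_right (1 - \<mu>) (poly_zero_ext a b (pderiv p)) x) (at x)"
    using \<mu> by (intro has_vector_derivative_transform_within_open[OF RL_integral_right_has_vector_derivative[OF _ x pb], of _ "{a<..<b}"])
      (use x eq in auto)
  then show ?thesis unfolding RL_right_def by (simp add: vector_derivative_at)
qed

section \<open>The bilinear form on polynomials vanishing at the end points\<close>

text \<open>
  The function \<open>u\<close> is determined only on the open interval, so the end point conditions
  are conditions on the polynomial that represents it.
\<close>

definition poly_vanishing_at_ends :: "real \<Rightarrow> real \<Rightarrow> (real \<Rightarrow> complex) \<Rightarrow> complex poly \<Rightarrow> bool" where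
  "poly_vanishing_at_ends a b u p \<longleftrightarrow>
     (\<forall>x\<in>{a<..<b}. u x = poly p (complex_of_real x)) \<and>
     poly p (complex_of_real a) = 0 \<and> poly p (complex_of_real b) = 0"

definition RL_pairing :: "real \<Rightarrow> real \<Rightarrow> real \<Rightarrow> complex poly \<Rightarrow> complex poly \<Rightarrow> complex" where
  "RL_pairing s a b p q = (LINT x|lborel. RL_integral s (poly_zero_ext a b (pderiv p)) x *
     cnj (RL_integral_right s (poly_zero_ext a b (pderiv q)) x))"

lemma poly_zero_ext_add: "poly_zero_ext a b (p + q) x = poly_zero_ext a b p x + poly_zero_ext a b q x"
  by (simp add: poly_zero_ext_def scaleR_add_right)

text \<open>
  Sesquilinearity is read off from the double integral over \<open>(\<xi>, \<eta>)\<close>, whose integrand is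
  integrable for any two polynomials.
\<close>

lemma
  assumes "0 < s" "a < b"
  shows RL_pairing_add_left: "RL_pairing s a b (p + p') q = RL_pairing s a b p q + RL_pairing s a b p' q"
    and RL_pairing_add_right: "RL_pairing s a b p (q + q') = RL_pairing s a b p q + RL_pairing s a b p q'"
    and RL_pairing_smult_left: "RL_pairing s a b (smult c p) q = c * RL_pairing s a b p q"
    and RL_pairing_smult_right: "RL_pairing s a b p (smult c q) = cnj c * RL_pairing s a b p q"
proof -
  define M where "M = (\<lambda>p. enn2real (\<integral>\<^sup>+w. ennreal (RL_kernel s w * RL_kernel s (1 - w)) \<partial>lborel) *
    RL_kernel (2 * s) (snd p - fst p))"
  define J where "J = (\<lambda>f g z. M z *\<^sub>R (poly_zero_ext a b f (fst z) * cnj (poly_zero_ext a b g (snd z))))"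
  have J: "integrable (lborel \<Otimes>\<^sub>M lborel) (J f g)" for f g
  proof -
    obtain C where C: "0 \<le> C" "\<And>x. cmod (poly_zero_ext a b f x) \<le> C * indicator {a<..<b} x"
      using poly_zero_ext_bounded[of a b f] by blast
    obtain D where D: "0 \<le> D" "\<And>x. cmod (poly_zero_ext a b g x) \<le> D * indicator {a<..<b} x"
      using poly_zero_ext_bounded[of a b g] by blast
    show ?thesis unfolding J_def M_def
      by (rule integrable_RL_integral_opposite_kernel[OF assms C(1) D(1) _ _ C(2) D(2)]) auto
  qed
  have eq: "RL_pairing s a b p q = (LINT z|(lborel \<Otimes>\<^sub>M lborel). J (pderiv p) (pderiv q) z)" for p q
  proof -
    obtain C where C: "0 \<le> C" "\<And>x. cmod (poly_zero_ext a b (pderiv p) x) \<le> C * indicator {a<..<b} x"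
      using poly_zero_ext_bounded[of a b "pderiv p"] by blast
    obtain D where D: "0 \<le> D" "\<And>x. cmod (poly_zero_ext a b (pderiv q) x) \<le> D * indicator {a<..<b} x"
      using poly_zero_ext_bounded[of a b "pderiv q"] by blast
    show ?thesis unfolding J_def M_def RL_pairing_def
      by (rule integral_RL_integral_opposite[OF assms C(1) D(1) _ _ C(2) D(2)]) auto
  qed
  have "J (pderiv (p + p')) (pderiv q) = (\<lambda>z. J (pderiv p) (pderiv q) z + J (pderiv p') (pderiv q) z)"
    "J (pderiv p) (pderiv (q + q')) = (\<lambda>z. J (pderiv p) (pderiv q) z + J (pderiv p) (pderiv q') z)"
    "J (pderiv (smult c p)) (pderiv q) = (\<lambda>z. c * J (pderiv p) (pderiv q) z)"
    "J (pderiv p) (pderiv (smult c q)) = (\<lambda>z. cnj c * J (pderiv p) (pderiv q) z)"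
    by (auto simp: J_def pderiv_add pderiv_smult poly_zero_ext_add poly_zero_ext_smult algebra_simps fun_eq_iff)
  note * = this
  show "RL_pairing s a b (p + p') q = RL_pairing s a b p q + RL_pairing s a b p' q"
    "RL_pairing s a b p (q + q') = RL_pairing s a b p q + RL_pairing s a b p q'"
    "RL_pairing s a b (smult c p) q = c * RL_pairing s a b p q"
    "RL_pairing s a b p (smult c q) = cnj c * RL_pairing s a b p q"
    unfolding eq * by (simp_all add: J)
qed

lemma Re_RL_pairing_nonneg:
  assumes "0 < s" "s < 1/2" "a < b"
  shows "0 \<le> Re (RL_pairing s a b p p)"
proof -
  obtain C where C: "0 \<le> C" "\<And>x. cmod (poly_zero_ext a b (pderiv p) x) \<le> C * indicator {a<..<b} x"
    using poly_zero_ext_bounded[of a b "pderiv p"] by blast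
  show ?thesis
    unfolding RL_pairing_def by (rule Re_RL_integral_opposite_nonneg[OF assms C(1) _ C(2)]) auto
qed

lemma RL_integral_eq_0: "x \<le> a \<Longrightarrow> RL_integral s (poly_zero_ext a b p) x = 0"
proof -
  assume "x \<le> a"
  then have "RL_kernel s (x - \<xi>) *\<^sub>R poly_zero_ext a b p \<xi> = 0" for \<xi>
    by (auto simp: RL_kernel_def poly_zero_ext_def indicator_def)
  then show ?thesis by (simp only: RL_integral_def Bochner_Integration.integral_zero)
qed

lemma RL_integral_right_eq_0: "b \<le> x \<Longrightarrow> RL_integral_right s (poly_zero_ext a b p) x = 0"
proof -
  assume "b \<le> x"
  then have "RL_kernel s (\<xi> - x) *\<^sub>R poly_zero_ext a b p \<xi> = 0" for \<xi>
    by (auto simp: RL_kernel_def poly_zero_ext_def indicator_def)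
  then show ?thesis by (simp only: RL_integral_right_def Bochner_Integration.integral_zero)
qed

lemma ip_cnj: "ip a b w u = cnj (ip a b u w)"
  by (simp add: ip_def mult.commute flip: Bochner_Integration.integral_cnj)

lemma RL_integral_measurable [measurable]:
  assumes [measurable]: "f \<in> borel_measurable borel"
  shows "RL_integral s f \<in> borel_measurable borel" "RL_integral_right s f \<in> borel_measurable borel"
  unfolding RL_integral_def RL_integral_right_def by measurable

text \<open>
  The inner product over \<open>(a, b)\<close> equals an integral over the whole line: to the left of
  \<open>a\<close> the left fractional integral is zero, to the right of \<open>b\<close> the right one.
\<close>

lemma ip_RL_left_right:
  assumes \<mu>: "\<mu> < 1"
    and u: "poly_vanishing_at_ends a b u p" and w: "poly_vanishing_at_ends a b w q"
  shows "ip a b (RL_left a \<mu> u) (RL_right b \<mu> w) 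
    = complex_of_real (- (1 / (Gamma (1 - \<mu>))\<^sup>2)) * RL_pairing (1 - \<mu>) a b p q"
proof -
  define A where "A = RL_integral (1 - \<mu>) (poly_zero_ext a b (pderiv p))"
  define B where "B = RL_integral_right (1 - \<mu>) (poly_zero_ext a b (pderiv q))"
  define c where "c = complex_of_real (- (1 / (Gamma (1 - \<mu>))\<^sup>2))"
  have [measurable]: "A \<in> borel_measurable borel" "B \<in> borel_measurable borel"
    unfolding A_def B_def by measurable
  have zero: "A x * cnj (B x) = 0" if "x \<notin> {a<..<b}" for x
    using that RL_integral_eq_0[of x a "1 - \<mu>" b "pderiv p"] RL_integral_right_eq_0[of b x "1 - \<mu>" a "pderiv q"] 
    by (auto simp: A_def B_def not_less)
  have "ip a b (RL_left a \<mu> u) (RL_right b \<mu> w) = (LINT x|lborel. c * (A x * cnj (B x)))"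
    unfolding ip_def
  proof (rule integral_lebesgue_on_eq_lborel)
    fix x
    show "c * (A x * cnj (B x)) = indicat_real {a<..<b} x *\<^sub>R (RL_left a \<mu> u x * cnj (RL_right b \<mu> w x))"
    proof (cases "x \<in> {a<..<b}")
      case True
      have "RL_left a \<mu> u x = complex_of_real (1 / Gamma (1 - \<mu>)) * A x"
        unfolding A_def using u by (intro RL_left_poly[OF \<mu> True]) (auto simp: poly_vanishing_at_ends_def)
      moreover have "RL_right b \<mu> w x = - complex_of_real (1 / Gamma (1 - \<mu>)) * B x"
        unfolding B_def using w by (intro RL_right_poly[OF \<mu> True]) (auto simp: poly_vanishing_at_ends_def)
      ultimately show ?thesis using True by (simp add: c_def power2_eq_square)
    qed (simp add: zero)
  qed auto
  then show ?thesis unfolding RL_pairing_def c_def A_def B_def by simp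
qed

lemma bform_poly:
  assumes "\<alpha> < 2"
    and u: "poly_vanishing_at_ends a b u p" and w: "poly_vanishing_at_ends a b w q"
  shows "bform a b \<alpha> u w = complex_of_real (- 1 / (2 * cos (\<alpha> * pi / 2) * (Gamma (1 - \<alpha> / 2))\<^sup>2)) *
    (RL_pairing (1 - \<alpha> / 2) a b p q + cnj (RL_pairing (1 - \<alpha> / 2) a b q p))"
proof -
  have \<mu>: "\<alpha> / 2 < 1" using assms by simp
  show ?thesis
    unfolding bform_def ip_cnj[of a b "RL_right b (\<alpha> / 2) u"] ip_RL_left_right[OF \<mu> u w] ip_RL_left_right[OF \<mu> w u]
    by (simp add: algebra_simps add_divide_distrib)
qed

lemma bform_cnj: "bform a b \<alpha> w u = cnj (bform a b \<alpha> u w)"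
  unfolding bform_def
  by (simp add: ip_cnj[of a b "RL_left a (\<alpha> / 2) w"] ip_cnj[of a b "RL_right b (\<alpha> / 2) w"] add.commute)

lemma poly_vanishing_at_ends_add:
  "poly_vanishing_at_ends a b u p \<Longrightarrow> poly_vanishing_at_ends a b v q \<Longrightarrow>
    poly_vanishing_at_ends a b (\<lambda>x. u x + v x) (p + q)"
  by (auto simp: poly_vanishing_at_ends_def)

lemma poly_vanishing_at_ends_scaleR:
  "poly_vanishing_at_ends a b u p \<Longrightarrow> poly_vanishing_at_ends a b (\<lambda>x. c *\<^sub>R u x) (smult (complex_of_real c) p)"
  by (auto simp: poly_vanishing_at_ends_def scaleR_conv_of_real)

lemma bform_add_left:
  assumes "a < b" "\<alpha> < 2"
    and u: "poly_vanishing_at_ends a b u p" and v: "poly_vanishing_at_ends a b v q" 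
    and w: "poly_vanishing_at_ends a b w r"
  shows "bform a b \<alpha> (\<lambda>x. u x + v x) w = bform a b \<alpha> u w + bform a b \<alpha> v w"
  unfolding bform_poly[OF assms(2) u w] bform_poly[OF assms(2) v w] 
    bform_poly[OF assms(2) poly_vanishing_at_ends_add[OF u v] w]
  using assms(1,2) by (simp add: RL_pairing_add_left RL_pairing_add_right algebra_simps add_divide_distrib)

lemma bform_scaleR_left:
  assumes "a < b" "\<alpha> < 2" and u: "poly_vanishing_at_ends a b u p" and w: "poly_vanishing_at_ends a b w r"
  shows "bform a b \<alpha> (\<lambda>x. c *\<^sub>R u x) w = c *\<^sub>R bform a b \<alpha> u w"
  unfolding bform_poly[OF assms(2) u w] bform_poly[OF assms(2) poly_vanishing_at_ends_scaleR[OF u] w]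
  using assms(1,2) 
  by (simp add: RL_pairing_smult_left RL_pairing_smult_right scaleR_conv_of_real algebra_simps add_divide_distrib)

text \<open>
  Both the cosine and the sign of the right derivative are negative, and the pairing of fractional
  integrals has nonnegative real part.
\<close>

lemma Re_bform_nonneg:
  assumes "a < b" "1 < \<alpha>" "\<alpha> < 2" and u: "poly_vanishing_at_ends a b u p"
  shows "0 \<le> Re (bform a b \<alpha> u u)"
proof -
  have "0 < cos (pi - \<alpha> * pi / 2)"
    using assms by (intro cos_gt_zero_pi) (auto simp: field_simps)
  then have neg: "cos (\<alpha> * pi / 2) < 0" by simp
  define c where "c = - 1 / (2 * cos (\<alpha> * pi / 2) * (Gamma (1 - \<alpha> / 2))\<^sup>2)"
  have "0 \<le> c" unfolding c_def using neg by (intro divide_nonpos_nonpos mult_nonpos_nonneg[OF _ zero_le_power2]) auto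
  moreover have "0 \<le> Re (RL_pairing (1 - \<alpha> / 2) a b p p)"
    using assms by (intro Re_RL_pairing_nonneg) auto
  moreover have "bform a b \<alpha> u u = complex_of_real c * (RL_pairing (1 - \<alpha> / 2) a b p p + cnj (RL_pairing (1 - \<alpha> / 2) a b p p))"
    unfolding bform_poly[OF assms(3) u u] c_def ..
  ultimately show ?thesis by simp
qed

lemma integrable_poly_mult_cnj:
  assumes "\<And>x. x \<in> {a<..<b} \<Longrightarrow> u x = poly p (complex_of_real x)"
    and "\<And>x. x \<in> {a<..<b} \<Longrightarrow> w x = poly q (complex_of_real x)"
  shows "integrable (lebesgue_on {a<..<b}) (\<lambda>x. u x * cnj (w x))"
proof -
  define h where "h = (\<lambda>x. poly p (complex_of_real x) * cnj (poly q (complex_of_real x)))"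
  have [measurable]: "h \<in> borel_measurable borel" unfolding h_def by measurable
  have "integrable lborel (\<lambda>x. indicator {a..b} x *\<^sub>R h x)"
    unfolding h_def by (intro borel_integrable_compact continuous_intros) auto
  from integrable_mult_indicator[OF _ this, of "{a<..<b}"]
  have "integrable lborel (\<lambda>x. indicator {a<..<b} x *\<^sub>R indicator {a..b} x *\<^sub>R h x)" by simp
  also have "(\<lambda>x. indicator {a<..<b} x *\<^sub>R indicator {a..b} x *\<^sub>R h x) = (\<lambda>x. indicator {a<..<b} x *\<^sub>R (u x * cnj (w x)))"
    using assms by (auto simp: fun_eq_iff indicator_def h_def)
  finally have "integrable lborel (\<lambda>x. indicator {a<..<b} x *\<^sub>R (u x * cnj (w x)))" .
  then show ?thesis
    by (simp add: integrable_restrict_space integrable_completion)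
qed

lemma Re_ip_self: "Re (ip a b u u) = (LINT x|lebesgue_on {a<..<b}. (cmod (u x))\<^sup>2)"
  by (simp only: ip_def complex_norm_square[symmetric] integral_complex_of_real Re_complex_of_real)

lemma Im_ip_self: "Im (ip a b u u) = 0"
  by (simp only: ip_def complex_norm_square[symmetric] integral_complex_of_real Im_complex_of_real)

lemma l2norm_square: "(l2norm a b u)\<^sup>2 = Re (ip a b u u)"
  by (simp add: l2norm_def Re_ip_self)

section \<open>Linear structure of the fractional Sobolev spaces\<close>

lemma nn_integral_lebesgue_on_eq_lborel:
  "S \<in> sets borel \<Longrightarrow> (\<integral>\<^sup>+x. f x \<partial>lebesgue_on S) = (\<integral>\<^sup>+x. f x * indicator S x \<partial>lborel)"
  by (simp add: nn_integral_restrict_space nn_integral_completion)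

lemma cmod_add_square_le: "(cmod (z + w))\<^sup>2 \<le> 2 * (cmod z)\<^sup>2 + 2 * (cmod w)\<^sup>2"
proof -
  have "(cmod (z + w))\<^sup>2 \<le> (cmod z + cmod w)\<^sup>2"
    by (intro power_mono norm_triangle_ineq) auto
  also have "\<dots> \<le> 2 * (cmod z)\<^sup>2 + 2 * (cmod w)\<^sup>2"
    using zero_le_power2[of "cmod z - cmod w"] by (simp add: power2_eq_square algebra_simps)
  finally show ?thesis .
qed

lemma borel_measurable_id_lebesgue_on [measurable]: "(\<lambda>x. x) \<in> borel_measurable (lebesgue_on (S :: real set))"
  by (intro measurable_restrict_space1 measurable_completion) auto

lemma sigma_finite_lebesgue_on_interval: "sigma_finite_measure (lebesgue_on {a<..<b::real})"
proof -
  interpret finite_measure "lebesgue_on {a<..<b}"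
    by (intro finite_measure_lebesgue_on) auto
  show ?thesis ..
qed

context
  fixes \<mu> a b :: real and M :: "real measure"
  defines "M \<equiv> lebesgue_on {a<..<b}"
begin

interpretation sigma_finite_measure M
  unfolding M_def by (rule sigma_finite_lebesgue_on_interval)

lemma borel_measurable_id_M: "(\<lambda>x. x) \<in> borel_measurable M"
  unfolding M_def by measurable

lemma Gagliardo_measurable:
  assumes [measurable]: "u \<in> borel_measurable M"
  shows "(\<lambda>x. \<integral>\<^sup>+y. ennreal ((cmod (u x - u y))\<^sup>2 / \<bar>x - y\<bar> powr (1 + 2 * \<mu>)) \<partial>M) \<in> borel_measurable M"
    "x \<in> space M \<Longrightarrow> (\<lambda>y. ennreal ((cmod (u x - u y))\<^sup>2 / \<bar>x - y\<bar> powr (1 + 2 * \<mu>))) \<in> borel_measurable M"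
proof -
  note [measurable] = borel_measurable_id_M
  show "(\<lambda>x. \<integral>\<^sup>+y. ennreal ((cmod (u x - u y))\<^sup>2 / \<bar>x - y\<bar> powr (1 + 2 * \<mu>)) \<partial>M) \<in> borel_measurable M"
    by measurable
  show "(\<lambda>y. ennreal ((cmod (u x - u y))\<^sup>2 / \<bar>x - y\<bar> powr (1 + 2 * \<mu>))) \<in> borel_measurable M"
    by measurable
qed

text \<open>
  A substitute for the triangle inequality that stays with squared norms in \<^typ>\<open>ennreal\<close>:
  the constants are irrelevant for finiteness and approximation, and infinite norms are covered.
\<close>

lemma H_norm_sq_linear_combination_le:
  assumes u [measurable]: "u \<in> borel_measurable M" and v [measurable]: "v \<in> borel_measurable M"
  shows "H_norm_sq \<mu> a b (\<lambda>x. c *\<^sub>R u x + d *\<^sub>R v x) 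
    \<le> ennreal (2 * c\<^sup>2) * H_norm_sq \<mu> a b u + ennreal (2 * d\<^sup>2) * H_norm_sq \<mu> a b v"
proof -
  define k where "k = (\<lambda>x y :: real. \<bar>x - y\<bar> powr (1 + 2 * \<mu>))"
  define L where "L = (\<lambda>u. \<integral>\<^sup>+x. ennreal ((cmod (u x))\<^sup>2) \<partial>M)"
  define G where "G = (\<lambda>u x. \<integral>\<^sup>+y. ennreal ((cmod (u x - u y))\<^sup>2 / k x y) \<partial>M)"
  have H: "H_norm_sq \<mu> a b u = L u + (\<integral>\<^sup>+x. G u x \<partial>M)" for u :: "real \<Rightarrow> complex"
    by (simp add: H_norm_sq_def L_def G_def k_def M_def)
  have [measurable]: "G u \<in> borel_measurable M" "G v \<in> borel_measurable M"
    unfolding G_def k_def by (rule Gagliardo_measurable(1)[OF u], rule Gagliardo_measurable(1)[OF v])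
  define w where "w = (\<lambda>x. c *\<^sub>R u x + d *\<^sub>R v x)"
  have pt: "ennreal ((cmod (c *\<^sub>R z + d *\<^sub>R z'))\<^sup>2 / t) 
      \<le> ennreal (2 * c\<^sup>2) * ennreal ((cmod z)\<^sup>2 / t) + ennreal (2 * d\<^sup>2) * ennreal ((cmod z')\<^sup>2 / t)" 
    if "0 \<le> t" for z z' t
  proof -
    have "(cmod (c *\<^sub>R z + d *\<^sub>R z'))\<^sup>2 / t \<le> (2 * (cmod (c *\<^sub>R z))\<^sup>2 + 2 * (cmod (d *\<^sub>R z'))\<^sup>2) / t"
      using that by (intro divide_right_mono cmod_add_square_le)
    also have "\<dots> = 2 * c\<^sup>2 * ((cmod z)\<^sup>2 / t) + 2 * d\<^sup>2 * ((cmod z')\<^sup>2 / t)"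
      by (simp add: power_mult_distrib add_divide_distrib)
    finally have "ennreal ((cmod (c *\<^sub>R z + d *\<^sub>R z'))\<^sup>2 / t)
        \<le> ennreal (2 * c\<^sup>2 * ((cmod z)\<^sup>2 / t) + 2 * d\<^sup>2 * ((cmod z')\<^sup>2 / t))"
      by (rule ennreal_leI)
    also have "\<dots> = ennreal (2 * c\<^sup>2 * ((cmod z)\<^sup>2 / t)) + ennreal (2 * d\<^sup>2 * ((cmod z')\<^sup>2 / t))"
      using that by (intro ennreal_plus) auto
    also have "\<dots> = ennreal (2 * c\<^sup>2) * ennreal ((cmod z)\<^sup>2 / t) + ennreal (2 * d\<^sup>2) * ennreal ((cmod z')\<^sup>2 / t)"
      by (simp only: ennreal_mult'[of "2 * c\<^sup>2"] ennreal_mult'[of "2 * d\<^sup>2"] zero_le_mult_iff zero_le_power2 zero_le_numeral simp_thms)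
    finally show ?thesis .
  qed
  have "L w \<le> (\<integral>\<^sup>+x. ennreal (2 * c\<^sup>2) * ennreal ((cmod (u x))\<^sup>2) + ennreal (2 * d\<^sup>2) * ennreal ((cmod (v x))\<^sup>2) \<partial>M)"
    unfolding L_def w_def using pt[of 1] by (intro nn_integral_mono) auto
  also have "\<dots> = ennreal (2 * c\<^sup>2) * L u + ennreal (2 * d\<^sup>2) * L v"
    unfolding L_def by (simp add: nn_integral_add nn_integral_cmult)
  finally have L: "L w \<le> ennreal (2 * c\<^sup>2) * L u + ennreal (2 * d\<^sup>2) * L v" .
  have G: "G w x \<le> ennreal (2 * c\<^sup>2) * G u x + ennreal (2 * d\<^sup>2) * G v x" if "x \<in> space M" for x
  proof -
    have [measurable]: "(\<lambda>y. ennreal ((cmod (u x - u y))\<^sup>2 / k x y)) \<in> borel_measurable M"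
       "(\<lambda>y. ennreal ((cmod (v x - v y))\<^sup>2 / k x y)) \<in> borel_measurable M"
      unfolding k_def by (rule Gagliardo_measurable(2)[OF u that], rule Gagliardo_measurable(2)[OF v that])
    have "G w x \<le> (\<integral>\<^sup>+y. ennreal (2 * c\<^sup>2) * ennreal ((cmod (u x - u y))\<^sup>2 / k x y) 
       + ennreal (2 * d\<^sup>2) * ennreal ((cmod (v x - v y))\<^sup>2 / k x y) \<partial>M)"
      unfolding G_def
    proof (rule nn_integral_mono)
      fix y
      have "w x - w y = c *\<^sub>R (u x - u y) + d *\<^sub>R (v x - v y)"
        by (simp add: w_def algebra_simps)
      then show "ennreal ((cmod (w x - w y))\<^sup>2 / k x y) \<le> ennreal (2 * c\<^sup>2) * ennreal ((cmod (u x - u y))\<^sup>2 / k x y) 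
       + ennreal (2 * d\<^sup>2) * ennreal ((cmod (v x - v y))\<^sup>2 / k x y)"
        using pt[of "k x y"] by (simp add: k_def)
    qed
    also have "\<dots> = ennreal (2 * c\<^sup>2) * G u x + ennreal (2 * d\<^sup>2) * G v x"
      unfolding G_def by (simp add: nn_integral_add nn_integral_cmult)
    finally show ?thesis .
  qed
  have "(\<integral>\<^sup>+x. G w x \<partial>M) \<le> (\<integral>\<^sup>+x. ennreal (2 * c\<^sup>2) * G u x + ennreal (2 * d\<^sup>2) * G v x \<partial>M)"
    using G by (rule nn_integral_mono)
  also have "\<dots> = ennreal (2 * c\<^sup>2) * (\<integral>\<^sup>+x. G u x \<partial>M) + ennreal (2 * d\<^sup>2) * (\<integral>\<^sup>+x. G v x \<partial>M)"
    by (simp add: nn_integral_add nn_integral_cmult)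
  finally have "H_norm_sq \<mu> a b w \<le> (ennreal (2 * c\<^sup>2) * L u + ennreal (2 * d\<^sup>2) * L v) +
      (ennreal (2 * c\<^sup>2) * (\<integral>\<^sup>+x. G u x \<partial>M) + ennreal (2 * d\<^sup>2) * (\<integral>\<^sup>+x. G v x \<partial>M))"
    unfolding H by (intro add_mono L)
  then show ?thesis unfolding w_def H distrib_left by (simp only: add_ac)
qed

end

lemma H_norm_sq_cong:
  assumes "\<And>x. x \<in> {a<..<b} \<Longrightarrow> u x = v x"
  shows "H_norm_sq \<mu> a b u = H_norm_sq \<mu> a b v"
  unfolding H_norm_sq_def using assms 
  by (intro arg_cong2[where f = "(+)"] nn_integral_cong) auto

lemma smooth_on_add: "smooth_on f S \<Longrightarrow> smooth_on g S \<Longrightarrow> smooth_on (\<lambda>x. f x + g x) S"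
  unfolding smooth_on_def
proof (elim exE conjE)
  fix D E assume "\<forall>x\<in>S. D 0 x = f x" "\<forall>k. \<forall>x\<in>S. (D k has_vector_derivative D (Suc k) x) (at x within S)"
    "\<forall>x\<in>S. E 0 x = g x" "\<forall>k. \<forall>x\<in>S. (E k has_vector_derivative E (Suc k) x) (at x within S)"
  then show "\<exists>D. (\<forall>x\<in>S. D 0 x = f x + g x) \<and> (\<forall>k. \<forall>x\<in>S. (D k has_vector_derivative D (Suc k) x) (at x within S))"
    by (intro exI[of _ "\<lambda>k x. D k x + E k x"]) (auto intro: has_vector_derivative_add)
qed

lemma smooth_on_scaleR: "smooth_on f S \<Longrightarrow> smooth_on (\<lambda>x. c *\<^sub>R f x) S"
  unfolding smooth_on_def
proof (elim exE conjE)
  fix D assume "\<forall>x\<in>S. D 0 x = f x" "\<forall>k. \<forall>x\<in>S. (D k has_vector_derivative D (Suc k) x) (at x within S)"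
  then show "\<exists>D. (\<forall>x\<in>S. D 0 x = c *\<^sub>R f x) \<and> (\<forall>k. \<forall>x\<in>S. (D k has_vector_derivative D (Suc k) x) (at x within S))"
    by (intro exI[of _ "\<lambda>k x. c *\<^sub>R D k x"]) 
       (auto intro!: bounded_linear.has_vector_derivative[OF bounded_linear_scaleR_right])
qed

lemma test_functions_linear_combination:
  assumes "\<phi> \<in> test_functions a b" "\<psi> \<in> test_functions a b"
  shows "(\<lambda>x. c *\<^sub>R \<phi> x + d *\<^sub>R \<psi> x) \<in> test_functions a b"
proof -
  obtain K where K: "compact K" "K \<subseteq> {a<..<b}" "\<forall>x. x \<notin> K \<longrightarrow> \<phi> x = 0"
    using assms(1) by (auto simp: test_functions_def)
  obtain L where L: "compact L" "L \<subseteq> {a<..<b}" "\<forall>x. x \<notin> L \<longrightarrow> \<psi> x = 0"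
    using assms(2) by (auto simp: test_functions_def)
  have "smooth_on (\<lambda>x. c *\<^sub>R \<phi> x + d *\<^sub>R \<psi> x) UNIV"
    using assms by (intro smooth_on_add smooth_on_scaleR) (auto simp: test_functions_def)
  moreover have "compact (K \<union> L)" "K \<union> L \<subseteq> {a<..<b}" "\<forall>x. x \<notin> K \<union> L \<longrightarrow> c *\<^sub>R \<phi> x + d *\<^sub>R \<psi> x = 0"
    using K L by (auto intro: compact_Un)
  ultimately show ?thesis unfolding test_functions_def by blast
qed

lemma test_function_continuous: "\<phi> \<in> test_functions a b \<Longrightarrow> continuous_on UNIV \<phi>"
proof -
  assume "\<phi> \<in> test_functions a b"
  then obtain D where D: "\<And>x. D 0 x = \<phi> x" "\<And>k x. (D k has_vector_derivative D (Suc k) x) (at x)"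
    by (auto simp: test_functions_def smooth_on_def)
  then have "D 0 = \<phi>" by auto
  moreover have "continuous_on UNIV (D 0)"
    by (intro continuous_at_imp_continuous_on ballI has_vector_derivative_continuous[OF D(2)])
  ultimately show ?thesis by simp
qed

text \<open>
  A test function is Lipschitz continuous, so the Gagliardo integrand is bounded by a multiple of
  \<open>\<bar>x - y\<bar> powr (1 - 2 * \<mu>)\<close>, whose exponent exceeds \<open>-1\<close>.
\<close>

lemma test_function_in_H_space:
  assumes "a < b" "\<mu> < 1" and \<phi>: "\<phi> \<in> test_functions a b"
  shows "\<phi> \<in> H_space \<mu> a b"
proof -
  obtain D where D: "\<And>x. D 0 x = \<phi> x" "\<And>k x. (D k has_vector_derivative D (Suc k) x) (at x)"
    using \<phi> by (auto simp: test_functions_def smooth_on_def)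
  have D0: "D 0 = \<phi>" using D(1) by auto
  have cont: "continuous_on S (D k)" for k S
    by (intro continuous_at_imp_continuous_on ballI has_vector_derivative_continuous[OF D(2)])
  have bdd: "\<exists>B\<ge>0. \<forall>x\<in>{a..b}. cmod (D k x) \<le> B" for k
  proof -
    have "bounded (D k ` {a..b})" by (intro compact_imp_bounded compact_continuous_image cont) auto
    then show ?thesis by (auto simp: bounded_pos intro: less_imp_le)
  qed
  obtain B where B: "0 \<le> B" "\<And>x. x \<in> {a..b} \<Longrightarrow> cmod (\<phi> x) \<le> B" using bdd[of 0] D0 by auto
  obtain L where L: "0 \<le> L" "\<And>x. x \<in> {a..b} \<Longrightarrow> cmod (D 1 x) \<le> L" using bdd[of 1] by auto
  have lip: "cmod (\<phi> x - \<phi> y) \<le> L * \<bar>x - y\<bar>" if "x \<in> {a..b}" "y \<in> {a..b}" for x y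
  proof -
    have "norm (\<phi> x - \<phi> y) \<le> L * norm (x - y)"
    proof (rule differentiable_bound[of "{a..b}" \<phi> "\<lambda>x h. h *\<^sub>R D 1 x"])
      show "(\<phi> has_derivative (\<lambda>h. h *\<^sub>R D 1 x)) (at x within {a..b})" for x
        using D(2)[of 0 x] unfolding D0 has_vector_derivative_def One_nat_def 
        by (rule has_derivative_at_withinI)
      show "onorm (\<lambda>h. h *\<^sub>R D 1 x) \<le> L" if "x \<in> {a..b}" for x
        using L(2)[OF that] L(1) by (intro onorm_le) (simp add: mult.commute[of L] mult_left_mono)
    qed (use that in auto)
    then show ?thesis by simp
  qed
  define E where "E = ennreal (2 * (b - a) powr (1 - 2 * \<mu> + 1) / (1 - 2 * \<mu> + 1))"
  have "(\<integral>\<^sup>+x. ennreal ((cmod (\<phi> x))\<^sup>2) \<partial>lebesgue_on {a<..<b}) \<le> (\<integral>\<^sup>+x. ennreal (B\<^sup>2) * indicator {a<..<b} x \<partial>lborel)"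
    using B by (subst nn_integral_lebesgue_on_eq_lborel)
      (auto intro!: nn_integral_mono ennreal_leI power_mono simp: indicator_def)
  also have "\<dots> < \<infinity>" using assms(1) by (subst nn_integral_cmult_indicator) (auto simp: ennreal_mult_less_top)
  finally have 1: "(\<integral>\<^sup>+x. ennreal ((cmod (\<phi> x))\<^sup>2) \<partial>lebesgue_on {a<..<b}) < \<infinity>" .
  have inner: "(\<integral>\<^sup>+y. ennreal ((cmod (\<phi> x - \<phi> y))\<^sup>2 / \<bar>x - y\<bar> powr (1 + 2 * \<mu>)) \<partial>lebesgue_on {a<..<b}) 
      \<le> ennreal (L\<^sup>2) * E" if x: "x \<in> {a<..<b}" for x
  proof -
    have "(\<integral>\<^sup>+y. ennreal ((cmod (\<phi> x - \<phi> y))\<^sup>2 / \<bar>x - y\<bar> powr (1 + 2 * \<mu>)) \<partial>lebesgue_on {a<..<b})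
      \<le> (\<integral>\<^sup>+y. ennreal (L\<^sup>2) * (ennreal (\<bar>x - y\<bar> powr (1 - 2 * \<mu>)) * indicator {a<..<b} y) \<partial>lborel)"
    proof (subst nn_integral_lebesgue_on_eq_lborel, simp, rule nn_integral_mono)
      fix y
      show "ennreal ((cmod (\<phi> x - \<phi> y))\<^sup>2 / \<bar>x - y\<bar> powr (1 + 2 * \<mu>)) * indicator {a<..<b} y
         \<le> ennreal (L\<^sup>2) * (ennreal (\<bar>x - y\<bar> powr (1 - 2 * \<mu>)) * indicator {a<..<b} y)"
      proof (cases "y \<in> {a<..<b} \<and> x \<noteq> y")
        case True
        have "(cmod (\<phi> x - \<phi> y))\<^sup>2 \<le> (L * \<bar>x - y\<bar>)\<^sup>2"
          using x True by (intro power_mono lip) auto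
        then have "(cmod (\<phi> x - \<phi> y))\<^sup>2 / \<bar>x - y\<bar> powr (1 + 2 * \<mu>) \<le> (L * \<bar>x - y\<bar>)\<^sup>2 / \<bar>x - y\<bar> powr (1 + 2 * \<mu>)"
          by (rule divide_right_mono) auto
        also have "\<dots> = L\<^sup>2 * (\<bar>x - y\<bar> powr 2 / \<bar>x - y\<bar> powr (1 + 2 * \<mu>))"
          using True by (simp add: power_mult_distrib)
        also have "\<bar>x - y\<bar> powr 2 / \<bar>x - y\<bar> powr (1 + 2 * \<mu>) = \<bar>x - y\<bar> powr (2 - (1 + 2 * \<mu>))"
          by (rule powr_diff[symmetric])
        also have "2 - (1 + 2 * \<mu>) = 1 - 2 * \<mu>" by simp
        finally show ?thesis using True by (simp add: ennreal_leI flip: ennreal_mult)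
      qed auto
    qed
    also have "\<dots> = ennreal (L\<^sup>2) * (\<integral>\<^sup>+y. ennreal (\<bar>x - y\<bar> powr (1 - 2 * \<mu>)) * indicator {a<..<b} y \<partial>lborel)"
      by (rule nn_integral_cmult) simp
    also have "\<dots> \<le> ennreal (L\<^sup>2) * E"
      unfolding E_def using assms x by (intro mult_left_mono nn_integral_abs_powr_le) auto
    finally show ?thesis .
  qed
  have "(\<integral>\<^sup>+x. (\<integral>\<^sup>+y. ennreal ((cmod (\<phi> x - \<phi> y))\<^sup>2 / \<bar>x - y\<bar> powr (1 + 2 * \<mu>)) \<partial>lebesgue_on {a<..<b}) \<partial>lebesgue_on {a<..<b})
     \<le> (\<integral>\<^sup>+x. ennreal (L\<^sup>2) * E \<partial>lebesgue_on {a<..<b})"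
    using inner by (intro nn_integral_mono) auto
  also have "\<dots> = (\<integral>\<^sup>+x. ennreal (L\<^sup>2) * E * indicator {a<..<b} x \<partial>lborel)"
    by (rule nn_integral_lebesgue_on_eq_lborel) simp
  also have "\<dots> < \<infinity>"
    using assms(1) by (subst nn_integral_cmult_indicator) (auto simp: ennreal_mult_less_top E_def)
  finally have "H_norm_sq \<mu> a b \<phi> < \<infinity>" unfolding H_norm_sq_def using 1 by simp
  moreover have "\<phi> \<in> borel_measurable (lebesgue_on {a<..<b})"
    using test_function_continuous[OF \<phi>]
    by (intro measurable_restrict_space1 measurable_completion) (simp add: borel_measurable_continuous_onI)
  ultimately show ?thesis by (simp add: H_space_def)
qed

lemma H_space_linear_combination:
  assumes "u \<in> H_space \<mu> a b" "v \<in> H_space \<mu> a b"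
  shows "(\<lambda>x. c *\<^sub>R u x + d *\<^sub>R v x) \<in> H_space \<mu> a b"
  using H_norm_sq_linear_combination_le[of u a b v \<mu> c d] assms
  by (auto simp: H_space_def ennreal_mult_less_top less_top[symmetric] top_unique ennreal_mult_eq_top_iff)

text \<open>
  The real number \<open>H_norm\<close> is zero for functions of infinite norm, so smallness of
  \<open>H_norm\<close> is meaningful only because the differences of \<open>u\<close> and test functions
  have finite norm.  In this form smallness of the norm gives actual estimates.
\<close>

lemma H0_space_iff:
  assumes "a < b" "\<mu> < 1"
  shows "u \<in> H0_space \<mu> a b \<longleftrightarrow> u \<in> H_space \<mu> a b \<and>
     (\<forall>e>0. \<exists>\<phi>\<in>test_functions a b. H_norm_sq \<mu> a b (\<lambda>x. u x - \<phi> x) < ennreal e)"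
proof -
  have *: "(\<forall>e>0. \<exists>\<phi>\<in>test_functions a b. H_norm \<mu> a b (\<lambda>x. u x - \<phi> x) < e) \<longleftrightarrow>
     (\<forall>e>0. \<exists>\<phi>\<in>test_functions a b. H_norm_sq \<mu> a b (\<lambda>x. u x - \<phi> x) < ennreal e)"
    if u: "u \<in> H_space \<mu> a b"
  proof -
    have fin: "H_norm_sq \<mu> a b (\<lambda>x. u x - \<phi> x) < \<infinity>" if "\<phi> \<in> test_functions a b" for \<phi>
      using H_space_linear_combination[OF u test_function_in_H_space[OF assms that], of 1 "-1"]
      by (simp add: H_space_def)
    have 1: "H_norm \<mu> a b (\<lambda>x. u x - \<phi> x) < e \<longleftrightarrow> H_norm_sq \<mu> a b (\<lambda>x. u x - \<phi> x) < ennreal (e\<^sup>2)"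
      if \<phi>: "\<phi> \<in> test_functions a b" and e: "0 < e" for \<phi> e
    proof -
      obtain r where r: "0 \<le> r" "H_norm_sq \<mu> a b (\<lambda>x. u x - \<phi> x) = ennreal r"
        using fin[OF \<phi>] by (metis ennreal_cases less_irrefl infinity_ennreal_def)
      have "sqrt r < e \<longleftrightarrow> r < e\<^sup>2"
        using e r(1) real_sqrt_less_iff[of r "e\<^sup>2"] by simp
      with r show ?thesis by (simp add: H_norm_def ennreal_less_iff)
    qed
    show ?thesis
    proof safe
      fix e :: real assume L: "\<forall>e>0. \<exists>\<phi>\<in>test_functions a b. H_norm \<mu> a b (\<lambda>x. u x - \<phi> x) < e" and e: "0 < e"
      then obtain \<phi> where "\<phi> \<in> test_functions a b" "H_norm \<mu> a b (\<lambda>x. u x - \<phi> x) < sqrt e"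
        by (meson real_sqrt_gt_0_iff)
      then show "\<exists>\<phi>\<in>test_functions a b. H_norm_sq \<mu> a b (\<lambda>x. u x - \<phi> x) < ennreal e"
        using 1[of \<phi> "sqrt e"] e by auto
    next
      fix e :: real assume R: "\<forall>e>0. \<exists>\<phi>\<in>test_functions a b. H_norm_sq \<mu> a b (\<lambda>x. u x - \<phi> x) < ennreal e" and e: "0 < e"
      then obtain \<phi> where "\<phi> \<in> test_functions a b" "H_norm_sq \<mu> a b (\<lambda>x. u x - \<phi> x) < ennreal (e\<^sup>2)"
        by (meson zero_less_power)
      then show "\<exists>\<phi>\<in>test_functions a b. H_norm \<mu> a b (\<lambda>x. u x - \<phi> x) < e"
        using 1[of \<phi> e] e by auto
    qed
  qed
  then show ?thesis by (auto simp: H0_space_def)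
qed

lemma H0_space_linear_combination:
  assumes ab: "a < b" "\<mu> < 1" and u: "u \<in> H0_space \<mu> a b" and v: "v \<in> H0_space \<mu> a b"
  shows "(\<lambda>x. c *\<^sub>R u x + d *\<^sub>R v x) \<in> H0_space \<mu> a b"
  unfolding H0_space_iff[OF ab]
proof (intro conjI allI impI)
  have uH: "u \<in> H_space \<mu> a b" and vH: "v \<in> H_space \<mu> a b" 
    using u v by (auto simp: H0_space_def)
  show "(\<lambda>x. c *\<^sub>R u x + d *\<^sub>R v x) \<in> H_space \<mu> a b"
    using uH vH by (rule H_space_linear_combination)
  fix e :: real assume e: "0 < e"
  \<comment> \<open>The summand \<open>1\<close> keeps \<open>K\<close> positive and the final inequality strict.\<close>
  define K where "K = 2 * c\<^sup>2 + 2 * d\<^sup>2 + 1"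
  have K: "0 < K" by (auto simp: K_def intro: add_nonneg_pos)
  obtain \<phi> where \<phi>: "\<phi> \<in> test_functions a b" "H_norm_sq \<mu> a b (\<lambda>x. u x - \<phi> x) < ennreal (e / K)"
    using u e K unfolding H0_space_iff[OF ab] by (meson divide_pos_pos)
  obtain \<psi> where \<psi>: "\<psi> \<in> test_functions a b" "H_norm_sq \<mu> a b (\<lambda>x. v x - \<psi> x) < ennreal (e / K)"
    using v e K unfolding H0_space_iff[OF ab] by (meson divide_pos_pos)
  have meas: "(\<lambda>x. u x - \<phi> x) \<in> borel_measurable (lebesgue_on {a<..<b})"
    "(\<lambda>x. v x - \<psi> x) \<in> borel_measurable (lebesgue_on {a<..<b})"
    using uH vH test_function_in_H_space[OF ab \<phi>(1)] test_function_in_H_space[OF ab \<psi>(1)]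
    by (auto simp: H_space_def)
  have "H_norm_sq \<mu> a b (\<lambda>x. (c *\<^sub>R u x + d *\<^sub>R v x) - (c *\<^sub>R \<phi> x + d *\<^sub>R \<psi> x))
      = H_norm_sq \<mu> a b (\<lambda>x. c *\<^sub>R (u x - \<phi> x) + d *\<^sub>R (v x - \<psi> x))"
    by (simp add: algebra_simps)
  also have "\<dots> \<le> ennreal (2 * c\<^sup>2) * H_norm_sq \<mu> a b (\<lambda>x. u x - \<phi> x) + ennreal (2 * d\<^sup>2) * H_norm_sq \<mu> a b (\<lambda>x. v x - \<psi> x)"
    using meas by (rule H_norm_sq_linear_combination_le)
  also have "\<dots> \<le> ennreal (2 * c\<^sup>2) * ennreal (e / K) + ennreal (2 * d\<^sup>2) * ennreal (e / K)"
    using \<phi>(2) \<psi>(2) by (intro add_mono mult_left_mono) (auto intro: less_imp_le)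
  also have "\<dots> = ennreal ((K - 1) * (e / K))"
    using e K by (simp add: K_def algebra_simps add_divide_distrib flip: ennreal_mult ennreal_plus)
  also have "\<dots> < ennreal e"
    using e K by (intro ennreal_lessI) (auto simp: field_simps)
  finally show "\<exists>\<theta>\<in>test_functions a b. H_norm_sq \<mu> a b (\<lambda>x. (c *\<^sub>R u x + d *\<^sub>R v x) - \<theta> x) < ennreal e"
    by (intro bexI[of _ "\<lambda>x. c *\<^sub>R \<phi> x + d *\<^sub>R \<psi> x"] test_functions_linear_combination \<phi>(1) \<psi>(1))
qed

lemma X0_space_linear_combination:
  assumes "a < b" "\<alpha> < 2" "u \<in> X0_space a b \<alpha> N" "v \<in> X0_space a b \<alpha> N"
  shows "(\<lambda>x. c *\<^sub>R u x + d *\<^sub>R v x) \<in> X0_space a b \<alpha> N"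
proof -
  obtain p where p: "degree p \<le> N" "\<And>x. x \<in> {a<..<b} \<Longrightarrow> u x = poly p (complex_of_real x)"
    using assms(3) by (auto simp: X0_space_def poly_space_def)
  obtain q where q: "degree q \<le> N" "\<And>x. x \<in> {a<..<b} \<Longrightarrow> v x = poly q (complex_of_real x)"
    using assms(4) by (auto simp: X0_space_def poly_space_def)
  have "(\<lambda>x. c *\<^sub>R u x + d *\<^sub>R v x) \<in> poly_space a b N"
    unfolding poly_space_def
    by (rule CollectI, rule exI[of _ "smult (complex_of_real c) p + smult (complex_of_real d) q"])
       (auto simp: p q scaleR_conv_of_real intro!: degree_add_le order.trans[OF degree_smult_le])
  moreover have "(\<lambda>x. c *\<^sub>R u x + d *\<^sub>R v x) \<in> H0_space (\<alpha> / 2) a b"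
    using assms by (intro H0_space_linear_combination) (auto simp: X0_space_def)
  ultimately show ?thesis by (simp add: X0_space_def)
qed

section \<open>End point values in the fractional Sobolev spaces\<close>

definition mean_on :: "real \<Rightarrow> real \<Rightarrow> (real \<Rightarrow> complex) \<Rightarrow> complex" where
  "mean_on c d v = integral {c..d} v /\<^sub>R (d - c)"

lemma mean_on_has_integral:
  assumes "c < d" "continuous_on {c..d} v"
  shows "((\<lambda>y. v y - z) has_integral (d - c) *\<^sub>R (mean_on c d v - z)) {c..d}"
proof -
  have "(v has_integral integral {c..d} v) {c..d}"
    using assms(2) by (intro integrable_integral integrable_continuous_interval)
  from has_integral_diff[OF this has_integral_const_real[of z c d]] show ?thesis
    using assms(1) by (simp add: mean_on_def scaleR_diff_right)
qed

text \<open>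
  The inequality of Jensen for the square, obtained by integrating
  \<open>2 (w \<bullet> m) \<le> |w|\<^sup>2 + |m|\<^sup>2\<close> with \<open>w = v - z\<close> and \<open>m\<close> its mean.
\<close>

lemma mean_on_square_le:
  assumes cd: "c < d" and v: "continuous_on {c..d} v"
  shows "ennreal ((d - c) * (cmod (mean_on c d v - z))\<^sup>2) 
    \<le> (\<integral>\<^sup>+y. ennreal ((cmod (v y - z))\<^sup>2) * indicator {c<..<d} y \<partial>lborel)"
proof -
  define m where "m = mean_on c d v - z"
  define I where "I = integral {c..d} (\<lambda>y. (cmod (v y - z))\<^sup>2)"
  have I: "((\<lambda>y. (cmod (v y - z))\<^sup>2) has_integral I) {c..d}"
    unfolding I_def by (intro integrable_integral integrable_continuous_interval continuous_intros v)
  have "((\<lambda>y. (v y - z) \<bullet> m) has_integral (((d - c) *\<^sub>R m) \<bullet> m)) {c..d}"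
    using has_integral_linear[OF mean_on_has_integral[OF cd v, of z] bounded_linear_inner_left[of m]]
    by (simp add: m_def o_def)
  then have A: "((\<lambda>y. 2 * ((v y - z) \<bullet> m)) has_integral (2 * ((d - c) * (cmod m)\<^sup>2))) {c..d}"
    by (intro has_integral_mult_right) (simp add: power2_norm_eq_inner)
  have B: "((\<lambda>y. (cmod (v y - z))\<^sup>2 + (cmod m)\<^sup>2) has_integral (I + (d - c) * (cmod m)\<^sup>2)) {c..d}"
    using has_integral_add[OF I has_integral_const_real[of "(cmod m)\<^sup>2" c d]] cd by simp
  have "2 * ((d - c) * (cmod m)\<^sup>2) \<le> I + (d - c) * (cmod m)\<^sup>2"
  proof (rule has_integral_le[OF A B])
    fix y
    have "0 \<le> (cmod ((v y - z) - m))\<^sup>2" by simp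
    then show "2 * ((v y - z) \<bullet> m) \<le> (cmod (v y - z))\<^sup>2 + (cmod m)\<^sup>2"
      unfolding power2_norm_eq_inner by (simp add: inner_diff_left inner_diff_right inner_commute)
  qed
  then have "(d - c) * (cmod m)\<^sup>2 \<le> I" by simp
  then have "ennreal ((d - c) * (cmod m)\<^sup>2) \<le> ennreal I" by (rule ennreal_leI)
  also have "ennreal I = (\<integral>\<^sup>+y. ennreal ((cmod (v y - z))\<^sup>2) * indicator {c<..<d} y \<partial>lborel)"
    using I by (intro nn_integral_has_integral_lebesgue'[symmetric]) (auto simp: has_integral_Icc_iff_Ioo)
  finally show ?thesis unfolding m_def .
qed

lemma mean_on_diff_le:
  assumes cd: "c < d" and v: "continuous_on {c..d} v" and "0 \<le> B"
    and B: "\<And>y. y \<in> {c..d} \<Longrightarrow> cmod (v y - z) \<le> B"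
  shows "cmod (mean_on c d v - z) \<le> B"
proof -
  have "norm ((d - c) *\<^sub>R (mean_on c d v - z)) \<le> B * Henstock_Kurzweil_Integration.content {c..d}"
    by (rule has_integral_bound_real[OF assms(3) finite.emptyI mean_on_has_integral[OF cd v]]) (use B in auto)
  then show ?thesis using cd by (simp add: mult.commute)
qed

text \<open>
  Applying \<open>mean_on_square_le\<close> twice bounds the difference of the means over nested intervals by
  the double integral of \<open>|v x - v y|\<^sup>2\<close>; on the larger interval
  \<open>|x - y| \<le> d - c\<close>, so inserting the Gagliardo weight costs only a power of \<open>d - c\<close>.
\<close>

lemma mean_on_nested_le:
  assumes \<mu>: "0 \<le> \<mu>" and sub: "a \<le> c" "c \<le> c'" "c' < d'" "d' \<le> d" "d \<le> b"
    and v: "continuous_on {c..d} v" and meas: "v \<in> borel_measurable (lebesgue_on {a<..<b})"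
  shows "ennreal ((d' - c') * (cmod (mean_on c' d' v - mean_on c d v))\<^sup>2)
    \<le> ennreal ((d - c) powr (2 * \<mu>)) * H_norm_sq \<mu> a b v"
proof -
  define G where "G = (\<lambda>x. \<integral>\<^sup>+y. ennreal ((cmod (v x - v y))\<^sup>2 / \<bar>x - y\<bar> powr (1 + 2 * \<mu>)) \<partial>lebesgue_on {a<..<b})"
  define l where "l = d - c"
  have l: "0 < l" using sub by (simp add: l_def)
  have cd: "c < d" using sub by simp
  have pt: "ennreal ((cmod (v x - mean_on c d v))\<^sup>2) \<le> ennreal (l powr (2 * \<mu>)) * G x" if x: "x \<in> {c<..<d}" for x
  proof -
    have "ennreal (l * (cmod (mean_on c d v - v x))\<^sup>2) \<le> (\<integral>\<^sup>+y. ennreal ((cmod (v y - v x))\<^sup>2) * indicator {c<..<d} y \<partial>lborel)"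
      unfolding l_def by (rule mean_on_square_le[OF cd v])
    also have "\<dots> \<le> (\<integral>\<^sup>+y. ennreal (l powr (1 + 2 * \<mu>)) * 
        (ennreal ((cmod (v x - v y))\<^sup>2 / \<bar>x - y\<bar> powr (1 + 2 * \<mu>)) * indicator {a<..<b} y) \<partial>lborel)"
    proof (rule nn_integral_mono)
      fix y
      show "ennreal ((cmod (v y - v x))\<^sup>2) * indicator {c<..<d} y \<le> ennreal (l powr (1 + 2 * \<mu>)) * 
        (ennreal ((cmod (v x - v y))\<^sup>2 / \<bar>x - y\<bar> powr (1 + 2 * \<mu>)) * indicator {a<..<b} y)"
      proof (cases "y \<in> {c<..<d} \<and> x \<noteq> y")
        case True
        have "(cmod (v y - v x))\<^sup>2 = \<bar>x - y\<bar> powr (1 + 2 * \<mu>) * ((cmod (v x - v y))\<^sup>2 / \<bar>x - y\<bar> powr (1 + 2 * \<mu>))"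
          using True by (simp add: norm_minus_commute)
        also have "\<dots> \<le> l powr (1 + 2 * \<mu>) * ((cmod (v x - v y))\<^sup>2 / \<bar>x - y\<bar> powr (1 + 2 * \<mu>))"
          using True x \<mu> by (intro mult_right_mono powr_mono2) (auto simp: l_def)
        finally show ?thesis using True sub by (simp add: ennreal_leI flip: ennreal_mult')
      qed auto
    qed
    also have "\<dots> = (\<integral>\<^sup>+y. ennreal (l powr (1 + 2 * \<mu>)) * 
        ennreal ((cmod (v x - v y))\<^sup>2 / \<bar>x - y\<bar> powr (1 + 2 * \<mu>)) \<partial>lebesgue_on {a<..<b})"
      by (simp add: nn_integral_lebesgue_on_eq_lborel mult.assoc)
    also have "\<dots> = ennreal (l powr (1 + 2 * \<mu>)) * G x"
      unfolding G_def using x sub by (intro nn_integral_cmult Gagliardo_measurable(2) meas) auto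
    also have "\<dots> = ennreal l * (ennreal (l powr (2 * \<mu>)) * G x)"
      using l by (simp add: powr_add ennreal_mult' mult.assoc)
    finally have "ennreal l * ennreal ((cmod (mean_on c d v - v x))\<^sup>2) \<le> ennreal l * (ennreal (l powr (2 * \<mu>)) * G x)"
      using l by (simp add: ennreal_mult')
    then show ?thesis
      using l by (subst (asm) ennreal_mult_le_mult_iff) (auto simp: norm_minus_commute)
  qed
  have "continuous_on {c'..d'} v" by (rule continuous_on_subset[OF v]) (use sub in auto)
  from mean_on_square_le[OF sub(3) this, of "mean_on c d v"]
  have "ennreal ((d' - c') * (cmod (mean_on c' d' v - mean_on c d v))\<^sup>2)
    \<le> (\<integral>\<^sup>+x. ennreal ((cmod (v x - mean_on c d v))\<^sup>2) * indicator {c'<..<d'} x \<partial>lborel)" .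
  also have "\<dots> \<le> (\<integral>\<^sup>+x. ennreal (l powr (2 * \<mu>)) * G x * indicator {a<..<b} x \<partial>lborel)"
  proof (rule nn_integral_mono)
    fix x
    show "ennreal ((cmod (v x - mean_on c d v))\<^sup>2) * indicator {c'<..<d'} x 
      \<le> ennreal (l powr (2 * \<mu>)) * G x * indicator {a<..<b} x"
      using pt[of x] sub by (auto simp: indicator_def)
  qed
  also have "\<dots> = (\<integral>\<^sup>+x. ennreal (l powr (2 * \<mu>)) * G x \<partial>lebesgue_on {a<..<b})"
    by (simp add: nn_integral_lebesgue_on_eq_lborel)
  also have "\<dots> = ennreal (l powr (2 * \<mu>)) * (\<integral>\<^sup>+x. G x \<partial>lebesgue_on {a<..<b})"
    unfolding G_def by (intro nn_integral_cmult Gagliardo_measurable(1) meas)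
  also have "\<dots> \<le> ennreal (l powr (2 * \<mu>)) * H_norm_sq \<mu> a b v"
    unfolding H_norm_sq_def G_def by (intro mult_left_mono) auto
  finally show ?thesis unfolding l_def .
qed

lemma mean_on_whole_le:
  assumes "a < b" "continuous_on {a..b} v"
  shows "ennreal ((b - a) * (cmod (mean_on a b v))\<^sup>2) \<le> H_norm_sq \<mu> a b v"
proof -
  have "ennreal ((b - a) * (cmod (mean_on a b v))\<^sup>2) \<le> (\<integral>\<^sup>+x. ennreal ((cmod (v x))\<^sup>2) \<partial>lebesgue_on {a<..<b})"
    using mean_on_square_le[OF assms, of 0] by (simp add: nn_integral_lebesgue_on_eq_lborel)
  then show ?thesis unfolding H_norm_sq_def by (rule order.trans) simp
qed

text \<open>
  The first summand bounds the mean over the whole interval, the second one is the sum of the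
  geometric series that bounds the increments of the dyadic means.
\<close>

definition trace_const :: "real \<Rightarrow> real \<Rightarrow> real \<Rightarrow> real" where
  "trace_const \<mu> a b = 1 / sqrt (b - a) + 
     sqrt (2 * (b - a) powr (2 * \<mu> - 1)) / (1 - 2 powr (1/2 - \<mu>))"

text \<open>
  For \<open>\<mu> > 1/2\<close> the means over intervals of length \<open>(b - a) / 2 ^ k\<close> shrinking to
  \<open>e\<close> change from level \<open>k\<close> to level \<open>k + 1\<close> by at most a multiple of
  \<open>(2 powr (1/2 - \<mu>)) ^ k\<close>, and they tend to \<open>v e\<close>.
\<close>

lemma trace_bound_of_intervals:
  assumes ab: "a < b" and \<mu>: "1/2 < \<mu>" and v: "continuous_on {a..b} v" 
    and meas: "v \<in> borel_measurable (lebesgue_on {a<..<b})"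
    and c0: "c 0 = a" and l: "\<And>k. l k = (b - a) / 2 ^ k"
    and c: "\<And>k. c k \<le> c (Suc k)" "\<And>k. c (Suc k) + l (Suc k) \<le> c k + l k"
    and e: "\<And>k. e \<in> {c k..c k + l k}"
    and S: "0 \<le> S" "H_norm_sq \<mu> a b v \<le> ennreal S"
  shows "cmod (v e) \<le> trace_const \<mu> a b * sqrt S"
proof -
  define r :: real where "r = 2 powr (1/2 - \<mu>)"
  have r: "0 < r" "r < 1" using \<mu> by (auto simp: r_def intro!: powr_less_one)
  define A where "A = (\<lambda>k. mean_on (c k) (c k + l k) v)"
  define D where "D = sqrt (2 * (b - a) powr (2 * \<mu> - 1) * S)"
  have lpos: "0 < l k" for k using ab by (simp add: l)
  have ca: "a \<le> c k" for k using c0 c(1) by (induction k) (auto intro: order.trans)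
  have cb: "c k + l k \<le> b" for k
  proof (induction k)
    case 0 show ?case using c0 l[of 0] by simp
  next
    case (Suc k) show ?case using c(2)[of k] Suc by simp
  qed
  have cont: "continuous_on {c k..c k + l k} v" for k
    by (rule continuous_on_subset[OF v]) (use ca[of k] cb[of k] in auto)
  have step: "cmod (A (Suc k) - A k) \<le> D * r ^ k" for k
  proof -
    have "ennreal (l (Suc k) * (cmod (A (Suc k) - A k))\<^sup>2) \<le> ennreal (l k powr (2 * \<mu>)) * H_norm_sq \<mu> a b v"
      using mean_on_nested_le[of \<mu> a "c k" "c (Suc k)" "c (Suc k) + l (Suc k)" "c k + l k" b v] 
        \<mu> ca cb c lpos cont meas by (simp add: A_def)
    also have "\<dots> \<le> ennreal (l k powr (2 * \<mu>)) * ennreal S"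
      by (intro mult_left_mono S) auto
    also have "\<dots> = ennreal (l k powr (2 * \<mu>) * S)"
      by (simp add: ennreal_mult')
    finally have "l (Suc k) * (cmod (A (Suc k) - A k))\<^sup>2 \<le> l k powr (2 * \<mu>) * S"
      using S(1) by (subst (asm) ennreal_le_iff) auto
    moreover have "l (Suc k) = l k / 2" by (simp add: l)
    moreover have "l k powr (2 * \<mu>) = l k * l k powr (2 * \<mu> - 1)" using lpos[of k] by (simp add: powr_mult_base)
    ultimately have "l k * (cmod (A (Suc k) - A k))\<^sup>2 \<le> l k * (2 * l k powr (2 * \<mu> - 1) * S)"
      by (simp add: algebra_simps)
    then have "(cmod (A (Suc k) - A k))\<^sup>2 \<le> 2 * l k powr (2 * \<mu> - 1) * S"
      using lpos[of k] by simp
    also have "l k powr (2 * \<mu> - 1) = (b - a) powr (2 * \<mu> - 1) * (r ^ k)\<^sup>2"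
    proof -
      have "(r ^ k)\<^sup>2 = (r\<^sup>2) ^ k" by (simp add: power_mult[symmetric] mult.commute)
      also have "r\<^sup>2 = 2 powr (1 - 2 * \<mu>)"
        by (simp add: r_def power2_eq_square flip: powr_add)
      also have "(2 powr (1 - 2 * \<mu>)) ^ k = (2 ^ k) powr (1 - 2 * \<mu>)"
        by (simp add: powr_power powr_powr flip: powr_realpow) (simp add: mult.commute)
      also have "\<dots> = 1 / (2 ^ k) powr (2 * \<mu> - 1)"
        by (simp flip: powr_minus_divide)
      finally show ?thesis using ab by (simp add: l powr_divide)
    qed
    finally have "(cmod (A (Suc k) - A k))\<^sup>2 \<le> 2 * ((b - a) powr (2 * \<mu> - 1) * (r ^ k)\<^sup>2) * S" .
    also have "\<dots> = (D * r ^ k)\<^sup>2"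
      using S(1) by (simp add: D_def power_mult_distrib)
    finally show ?thesis
      by (rule power2_le_imp_le) (use r S(1) in \<open>auto simp: D_def\<close>)
  qed
  have A0: "cmod (A 0) \<le> sqrt S / sqrt (b - a)"
  proof -
    have "ennreal ((b - a) * (cmod (A 0))\<^sup>2) \<le> ennreal S"
      using mean_on_whole_le[OF ab v, of \<mu>] S(2) by (simp add: A_def c0 l)
    then have "(b - a) * (cmod (A 0))\<^sup>2 \<le> S" using S(1) by simp
    then have "(cmod (A 0))\<^sup>2 \<le> S / (b - a)" using ab by (simp add: field_simps)
    then have "cmod (A 0) \<le> sqrt (S / (b - a))" by (rule real_le_rsqrt)
    then show ?thesis by (simp add: real_sqrt_divide)
  qed
  have D0: "0 \<le> D" using S(1) by (simp add: D_def)
  have An: "cmod (A n) \<le> sqrt S / sqrt (b - a) + D / (1 - r)" for n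
  proof -
    have "A n = A 0 + (\<Sum>k<n. A (Suc k) - A k)" by (simp add: sum_lessThan_telescope)
    also have "cmod \<dots> \<le> cmod (A 0) + (\<Sum>k<n. cmod (A (Suc k) - A k))"
      by (intro order.trans[OF norm_triangle_ineq] add_left_mono norm_sum)
    also have "\<dots> \<le> sqrt S / sqrt (b - a) + (\<Sum>k<n. D * r ^ k)"
      by (intro add_mono A0 sum_mono step)
    also have "(\<Sum>k<n. D * r ^ k) = D * ((1 - r ^ n) / (1 - r))"
      using r by (simp add: sum_distrib_left[symmetric] sum_gp_strict)
    also have "\<dots> \<le> D * (1 / (1 - r))"
      using r D0 by (intro mult_left_mono divide_right_mono) auto
    finally show ?thesis by simp
  qed
  have "A \<longlonglongrightarrow> v e"
  proof (rule LIMSEQ_I)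
    fix \<epsilon> :: real assume "0 < \<epsilon>"
    moreover have "e \<in> {a..b}" using e[of 0] c0 l[of 0] by simp
    ultimately obtain \<delta> where \<delta>: "0 < \<delta>" "\<And>y. y \<in> {a..b} \<Longrightarrow> dist y e < \<delta> \<Longrightarrow> dist (v y) (v e) < \<epsilon> / 2"
      using v[unfolded continuous_on_iff] by (metis half_gt_zero)
    have "(\<lambda>k. (b - a) / 2 ^ k) \<longlonglongrightarrow> 0"
      using tendsto_mult_right_zero[OF LIMSEQ_realpow_zero[of "1 / 2 :: real"], of "b - a"]
      by (simp add: power_divide)
    then obtain n0 where n0: "\<And>k. n0 \<le> k \<Longrightarrow> l k < \<delta>"
      using \<delta>(1) ab unfolding LIMSEQ_iff l by fastforce
    have "norm (A k - v e) < \<epsilon>" if "n0 \<le> k" for k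
    proof -
      have "cmod (A k - v e) \<le> \<epsilon> / 2"
        unfolding A_def
      proof (rule mean_on_diff_le)
        fix y assume y: "y \<in> {c k..c k + l k}"
        then have "dist y e < \<delta>" using e[of k] n0[OF that] by (auto simp: dist_real_def)
        then show "cmod (v y - v e) \<le> \<epsilon> / 2"
          using \<delta>(2)[of y] y ca[of k] cb[of k] by (auto simp: dist_norm less_imp_le)
      qed (use lpos \<open>0 < \<epsilon>\<close> cont in auto)
      then show ?thesis using \<open>0 < \<epsilon>\<close> by simp
    qed
    then show "\<exists>n0. \<forall>k\<ge>n0. norm (A k - v e) < \<epsilon>" by blast
  qed
  then have "(\<lambda>k. cmod (A k)) \<longlonglongrightarrow> cmod (v e)" by (rule tendsto_norm)
  then have "cmod (v e) \<le> sqrt S / sqrt (b - a) + D / (1 - r)"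
    by (rule LIMSEQ_le_const2) (use An in blast)
  also have "\<dots> = trace_const \<mu> a b * sqrt S"
    by (simp add: trace_const_def D_def r_def real_sqrt_mult algebra_simps)
  finally show ?thesis .
qed

lemma trace_bound:
  assumes ab: "a < b" and \<mu>: "1/2 < \<mu>" and v: "continuous_on {a..b} v" 
    and S: "0 \<le> S" "H_norm_sq \<mu> a b v \<le> ennreal S" and e: "e = a \<or> e = b"
  shows "cmod (v e) \<le> trace_const \<mu> a b * sqrt S"
proof -
  define l where "l = (\<lambda>k::nat. (b - a) / 2 ^ k)"
  have meas: "v \<in> borel_measurable (lebesgue_on {a<..<b})"
    by (intro continuous_imp_measurable_on_sets_lebesgue continuous_on_subset[OF v]) auto
  show ?thesis using e
  proof
    assume "e = a"
    then show ?thesis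
      using ab by (intro trace_bound_of_intervals[OF ab \<mu> v meas, where c = "\<lambda>_. a" and l = l] S)
        (auto simp: l_def field_simps)
  next
    assume "e = b"
    then show ?thesis
      \<comment> \<open>Intervals with fixed right end point: the left end points move to the right.\<close>
      using ab by (intro trace_bound_of_intervals[OF ab \<mu> v meas, where c = "\<lambda>k. b - l k" and l = l] S)
        (auto simp: l_def field_simps)
  qed
qed

text \<open>
  Subtracting a test function does not change the end point values, and the remaining norm can be
  made arbitrarily small.
\<close>

lemma H0_polynomial_vanishes_at_ends:
  assumes ab: "a < b" and \<mu>: "1/2 < \<mu>" "\<mu> < 1" and u: "u \<in> H0_space \<mu> a b"
    and p: "\<And>x. x \<in> {a<..<b} \<Longrightarrow> u x = poly p (complex_of_real x)"
  shows "poly_vanishing_at_ends a b u p"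
proof -
  have "poly p (complex_of_real e) = 0" if e: "e = a \<or> e = b" for e
  proof -
    have le: "cmod (poly p (complex_of_real e)) \<le> trace_const \<mu> a b * sqrt \<epsilon>" if \<epsilon>: "0 < \<epsilon>" for \<epsilon>
    proof -
      obtain \<phi> where \<phi>: "\<phi> \<in> test_functions a b" "H_norm_sq \<mu> a b (\<lambda>x. u x - \<phi> x) < ennreal \<epsilon>"
        using u \<epsilon> unfolding H0_space_iff[OF ab \<mu>(2)] by blast
      define v where "v = (\<lambda>x. poly p (complex_of_real x) - \<phi> x)"
      have "\<phi> e = 0" using \<phi>(1) e by (fastforce simp: test_functions_def)
      moreover have "continuous_on {a..b} v"
        unfolding v_def by (intro continuous_intros continuous_on_subset[OF test_function_continuous[OF \<phi>(1)]]) auto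
      moreover have "H_norm_sq \<mu> a b v = H_norm_sq \<mu> a b (\<lambda>x. u x - \<phi> x)"
        by (rule H_norm_sq_cong) (simp add: v_def p)
      ultimately show ?thesis
        using trace_bound[OF ab \<mu>(1), of v \<epsilon> e] e \<epsilon> \<phi>(2) by (auto simp: v_def)
    qed
    have "((\<lambda>\<epsilon>. trace_const \<mu> a b * sqrt \<epsilon>) \<longlongrightarrow> trace_const \<mu> a b * sqrt 0) (at_right 0)"
      by (intro tendsto_intros)
    then have "cmod (poly p (complex_of_real e)) \<le> trace_const \<mu> a b * sqrt 0"
      by (rule tendsto_lowerbound) (auto simp: eventually_at_right_less le intro!: eventually_mono[OF eventually_at_right_less])
    then show ?thesis by simp
  qed
  then show ?thesis using p by (auto simp: poly_vanishing_at_ends_def)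
qed

section \<open>The energy balance\<close>

lemma ip_add_left:
  assumes u: "poly_vanishing_at_ends a b u p" and v: "poly_vanishing_at_ends a b v q"
    and w: "poly_vanishing_at_ends a b w r"
  shows "ip a b (\<lambda>x. u x + v x) w = ip a b u w + ip a b v w"
proof -
  have "integrable (lebesgue_on {a<..<b}) (\<lambda>x. u x * cnj (w x))" 
       "integrable (lebesgue_on {a<..<b}) (\<lambda>x. v x * cnj (w x))"
    using u v w by (auto simp: poly_vanishing_at_ends_def intro!: integrable_poly_mult_cnj[of a b u p w r]
      integrable_poly_mult_cnj[of a b v q w r])
  then show ?thesis by (simp add: ip_def distrib_right)
qed

lemma ip_scaleR_left: "ip a b (\<lambda>x. c *\<^sub>R u x) w = c *\<^sub>R ip a b u w"
  by (simp add: ip_def)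

text \<open>
  The polarisation step: in \<open>F(u + v, u - v)\<close> the mixed terms \<open>F(v, u) - F(u, v)\<close>
  are purely imaginary.  It is stated for a set \<open>V\<close> of functions because both forms
  involve integrals and are additive only on suitable functions.
\<close>

lemma Re_hermitian_form_sum_difference:
  fixes F :: "('x \<Rightarrow> complex) \<Rightarrow> ('x \<Rightarrow> complex) \<Rightarrow> complex"
  assumes V: "\<And>u v. u \<in> V \<Longrightarrow> v \<in> V \<Longrightarrow> (\<lambda>x. u x + v x) \<in> V" 
      "\<And>(c :: real) u. u \<in> V \<Longrightarrow> (\<lambda>x. c *\<^sub>R u x) \<in> V"
    and add: "\<And>u v w. u \<in> V \<Longrightarrow> v \<in> V \<Longrightarrow> w \<in> V \<Longrightarrow> F (\<lambda>x. u x + v x) w = F u w + F v w"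
    and scale: "\<And>(c :: real) u w. u \<in> V \<Longrightarrow> w \<in> V \<Longrightarrow> F (\<lambda>x. c *\<^sub>R u x) w = c *\<^sub>R F u w"
    and herm: "\<And>u w. F w u = cnj (F u w)"
    and uv: "u \<in> V" "v \<in> V"
  shows "Re (F (\<lambda>x. c *\<^sub>R (u x + v x)) (\<lambda>x. d *\<^sub>R (u x - v x))) = c * d * (Re (F u u) - Re (F v v))"
proof -
  define s where "s = (\<lambda>x. u x + v x)"
  define t where "t = (\<lambda>x. u x + (- 1) *\<^sub>R v x)"
  have s: "s \<in> V" and t: "t \<in> V" unfolding s_def t_def using V uv by blast+
  have Ft: "F t w = F u w - F v w" if "w \<in> V" for w
    unfolding t_def using add[OF uv(1) V(2)[OF uv(2), of "- 1"] that] scale[OF uv(2) that, of "- 1"] by simp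
  have Fs: "F s w = F u w + F v w" if "w \<in> V" for w
    unfolding s_def using add uv that by blast
  have "F (\<lambda>x. c *\<^sub>R s x) (\<lambda>x. d *\<^sub>R t x) = (c * d) *\<^sub>R F s t"
    using scale[OF s V(2)[OF t, of d], of c] scale[OF t s, of d] herm[of s t] herm[of s "\<lambda>x. d *\<^sub>R t x"]
    by (simp add: herm[of s "\<lambda>x. d *\<^sub>R t x"])
  moreover have "Re (F s t) = Re (F u u) - Re (F v v)"
    using Fs[OF t] herm[of u t] herm[of v t] Ft[OF uv(1)] Ft[OF uv(2)] herm[of u v] by simp
  moreover have "(\<lambda>x. c *\<^sub>R (u x + v x)) = (\<lambda>x. c *\<^sub>R s x)" "(\<lambda>x. d *\<^sub>R (u x - v x)) = (\<lambda>x. d *\<^sub>R t x)"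
    by (auto simp: s_def t_def)
  ultimately show ?thesis by simp
qed

lemma
  assumes ab: "a < b" and \<alpha>: "\<alpha> < 2"
    and u: "poly_vanishing_at_ends a b u p" and v: "poly_vanishing_at_ends a b v q"
  shows Re_bform_sum_difference: 
      "Re (bform a b \<alpha> (\<lambda>x. c *\<^sub>R (u x + v x)) (\<lambda>x. d *\<^sub>R (u x - v x)))
         = c * d * (Re (bform a b \<alpha> u u) - Re (bform a b \<alpha> v v))"
    and Re_ip_sum_difference: 
      "Re (ip a b (\<lambda>x. c *\<^sub>R (u x + v x)) (\<lambda>x. d *\<^sub>R (u x - v x)))
         = c * d * (Re (ip a b u u) - Re (ip a b v v))"
proof -
  define V where "V = {u. \<exists>p. poly_vanishing_at_ends a b u p}"
  have V: "(\<lambda>x. u x + v x) \<in> V" if "u \<in> V" "v \<in> V" for u v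
    using that poly_vanishing_at_ends_add unfolding V_def by blast
  have V': "(\<lambda>x. c *\<^sub>R u x) \<in> V" if "u \<in> V" for u and c :: real
    using that poly_vanishing_at_ends_scaleR unfolding V_def by blast
  have uv: "u \<in> V" "v \<in> V" using u v by (auto simp: V_def)
  show "Re (bform a b \<alpha> (\<lambda>x. c *\<^sub>R (u x + v x)) (\<lambda>x. d *\<^sub>R (u x - v x)))
         = c * d * (Re (bform a b \<alpha> u u) - Re (bform a b \<alpha> v v))"
    by (rule Re_hermitian_form_sum_difference[where V = V, OF V V' _ _ bform_cnj uv])
       (auto simp: V_def intro: bform_add_left[OF ab \<alpha>] bform_scaleR_left[OF ab \<alpha>])
  show "Re (ip a b (\<lambda>x. c *\<^sub>R (u x + v x)) (\<lambda>x. d *\<^sub>R (u x - v x)))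
         = c * d * (Re (ip a b u u) - Re (ip a b v v))"
    by (rule Re_hermitian_form_sum_difference[where V = V, OF V V' _ _ ip_cnj uv])
       (auto simp: V_def intro: ip_add_left ip_scaleR_left)
qed

lemma X0_space_vanishes_at_ends:
  assumes "a < b" "1 < \<alpha>" "\<alpha> < 2" "u \<in> X0_space a b \<alpha> N"
  obtains p where "poly_vanishing_at_ends a b u p"
proof -
  obtain p where p: "\<And>x. x \<in> {a<..<b} \<Longrightarrow> u x = poly p (complex_of_real x)"
    using assms(4) by (auto simp: X0_space_def poly_space_def)
  have "poly_vanishing_at_ends a b u p"
    using assms by (intro H0_polynomial_vanishes_at_ends[where \<mu> = "\<alpha> / 2"] p) (auto simp: X0_space_def)
  then show thesis by (rule that)
qed

text \<open>
  The approximations \<open>Ut\<close>, \<open>\<Phi>t\<close> and \<open>Pt\<close> are arbitrary: they enter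
  the tested equations and the equation for \<open>ln P\<close> through the same two inner products and
  cancel.  So the first step and the later ones need no distinction.
\<close>

lemma energy_step:
  assumes ab: "a < b" and \<alpha>: "1 < \<alpha>" "\<alpha> < 2" and \<tau>: "0 < \<tau>"
    and X: "U n \<in> X0_space a b \<alpha> N" "U (n + 1) \<in> X0_space a b \<alpha> N"
      "cfun (\<Phi> n) \<in> X0_space a b \<alpha> N" "cfun (\<Phi> (n + 1)) \<in> X0_space a b \<alpha> N"
      "cfun (\<Psi> n) \<in> X0_space a b \<alpha> N" "cfun (\<Psi> (n + 1)) \<in> X0_space a b \<alpha> N"
    and step: "esav_step a b \<alpha> N lam \<kappa>1 \<kappa>2 \<gamma> \<eta> \<tau> U \<Phi> \<Psi> P n Ut \<Phi>t Pt"
  shows "energy a b \<alpha> lam \<gamma> \<eta> U \<Phi> \<Psi> P (n + 1) = energy a b \<alpha> lam \<gamma> \<eta> U \<Phi> \<Psi> P n"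
proof -
  define dU where "dU = (\<lambda>x. dquot \<tau> (\<lambda>m. U m x) n)"
  define d\<Phi> where "d\<Phi> = (\<lambda>x. dquot \<tau> (\<lambda>m. \<Phi> m x) n)"
  define d\<Psi> where "d\<Psi> = (\<lambda>x. dquot \<tau> (\<lambda>m. \<Psi> m x) n)"
  define Uh where "Uh = (\<lambda>x. avg (\<lambda>m. U m x) n)"
  define \<Phi>h where "\<Phi>h = (\<lambda>x. avg (\<lambda>m. \<Phi> m x) n)"
  define \<Psi>h where "\<Psi>h = (\<lambda>x. avg (\<lambda>m. \<Psi> m x) n)"
  define f where "f = (\<lambda>x. complex_of_real (Fnl a b \<kappa>1 \<kappa>2 Ut \<Phi>t x) * Ut x * complex_of_real (\<Phi>t x))"
  define g where "g = cfun (Gnl a b \<kappa>1 \<kappa>2 Ut \<Phi>t)"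
  from step have
    eU: "\<And>w. w \<in> X0_space a b \<alpha> N \<Longrightarrow> \<i> * ip a b dU w - complex_of_real (lam / 2) * bform a b \<alpha> Uh w
          + complex_of_real Pt * ip a b f w = 0" and
    e\<Phi>: "\<And>w. w \<in> X0_space a b \<alpha> N \<Longrightarrow> ip a b (cfun d\<Phi>) w = ip a b (cfun \<Psi>h) w" and
    e\<Psi>: "\<And>w. w \<in> X0_space a b \<alpha> N \<Longrightarrow> 
        ip a b (cfun d\<Psi>) w + complex_of_real \<gamma> * bform a b \<alpha> (cfun \<Phi>h) w
          + complex_of_real (\<eta>\<^sup>2) * ip a b (cfun \<Phi>h) w
          - complex_of_real Pt * ip a b g w = 0" and
    eP: "complex_of_real ((ln (P (n + 1)) - ln (P n)) / \<tau>) =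
        4 * complex_of_real Pt * complex_of_real (Re (ip a b f dU))
          + 2 * complex_of_real Pt * ip a b g (cfun d\<Phi>)"
    unfolding esav_step_def Let_def dU_def d\<Phi>_def d\<Psi>_def Uh_def \<Phi>h_def \<Psi>h_def f_def g_def by blast+
  define B where "B = (\<lambda>u. Re (bform a b \<alpha> u u))"
  define Q where "Q = (\<lambda>u. Re (ip a b u u))"
  have rep: "dU = (\<lambda>x. inverse \<tau> *\<^sub>R (U (n + 1) x - U n x))"
    "cfun d\<Phi> = (\<lambda>x. inverse \<tau> *\<^sub>R (cfun (\<Phi> (n + 1)) x - cfun (\<Phi> n) x))"
    "cfun d\<Psi> = (\<lambda>x. inverse \<tau> *\<^sub>R (cfun (\<Psi> (n + 1)) x - cfun (\<Psi> n) x))"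
    "Uh = (\<lambda>x. inverse 2 *\<^sub>R (U (n + 1) x + U n x))"
    "cfun \<Phi>h = (\<lambda>x. inverse 2 *\<^sub>R (cfun (\<Phi> (n + 1)) x + cfun (\<Phi> n) x))"
    "cfun \<Psi>h = (\<lambda>x. inverse 2 *\<^sub>R (cfun (\<Psi> (n + 1)) x + cfun (\<Psi> n) x))"
    by (simp_all add: dU_def d\<Phi>_def d\<Psi>_def Uh_def \<Phi>h_def \<Psi>h_def dquot_def avg_def scaleR_conv_of_real)
  have diff: "(\<lambda>x. inverse \<tau> *\<^sub>R (u x - v x)) \<in> X0_space a b \<alpha> N" 
    if "u \<in> X0_space a b \<alpha> N" "v \<in> X0_space a b \<alpha> N" for u v
    using X0_space_linear_combination[OF ab \<alpha>(2) that, of "inverse \<tau>" "- inverse \<tau>"]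
    by (simp add: scaleR_diff_right)
  have dX: "dU \<in> X0_space a b \<alpha> N" "cfun d\<Phi> \<in> X0_space a b \<alpha> N" "cfun d\<Psi> \<in> X0_space a b \<alpha> N"
    unfolding rep(1-3) by (intro diff X)+
  have form: "Re (bform a b \<alpha> (\<lambda>x. inverse 2 *\<^sub>R (u x + v x)) (\<lambda>x. inverse \<tau> *\<^sub>R (u x - v x))) = (B u - B v) / (2 * \<tau>)"
      "Re (ip a b (\<lambda>x. inverse 2 *\<^sub>R (u x + v x)) (\<lambda>x. inverse \<tau> *\<^sub>R (u x - v x))) = (Q u - Q v) / (2 * \<tau>)"
    if uv: "u \<in> X0_space a b \<alpha> N" "v \<in> X0_space a b \<alpha> N" for u v
  proof -
    obtain p where p: "poly_vanishing_at_ends a b u p" using X0_space_vanishes_at_ends[OF ab \<alpha> uv(1)] .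
    obtain q where q: "poly_vanishing_at_ends a b v q" using X0_space_vanishes_at_ends[OF ab \<alpha> uv(2)] .
    show "Re (bform a b \<alpha> (\<lambda>x. inverse 2 *\<^sub>R (u x + v x)) (\<lambda>x. inverse \<tau> *\<^sub>R (u x - v x))) = (B u - B v) / (2 * \<tau>)"
      "Re (ip a b (\<lambda>x. inverse 2 *\<^sub>R (u x + v x)) (\<lambda>x. inverse \<tau> *\<^sub>R (u x - v x))) = (Q u - Q v) / (2 * \<tau>)"
      unfolding Re_bform_sum_difference[OF ab \<alpha>(2) p q] Re_ip_sum_difference[OF ab \<alpha>(2) p q] B_def Q_def
      by (simp_all add: field_simps)
  qed
  have 1: "lam * ((B (U (n + 1)) - B (U n)) / (2 * \<tau>)) = 2 * Pt * Re (ip a b f dU)"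
  proof -
    \<comment> \<open>The first term is purely imaginary because \<open>ip a b dU dU\<close> is real.\<close>
    have "Re (\<i> * ip a b dU dU - complex_of_real (lam / 2) * bform a b \<alpha> Uh dU
          + complex_of_real Pt * ip a b f dU) = 0"
      using eU[OF dX(1)] by simp
    then have "lam * Re (bform a b \<alpha> Uh dU) = 2 * Pt * Re (ip a b f dU)"
      by (simp add: Im_ip_self)
    then show ?thesis unfolding rep(1,4) form(1)[OF X(2,1)] by simp
  qed
  have 2: "(Q (cfun (\<Psi> (n + 1))) - Q (cfun (\<Psi> n))) / (2 * \<tau>) = Re (ip a b (cfun d\<Psi>) (cfun d\<Phi>))"
  proof -
    have "Re (ip a b (cfun d\<Psi>) (cfun d\<Phi>)) = Re (ip a b (cfun d\<Phi>) (cfun d\<Psi>))"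
      by (subst ip_cnj) simp
    also have "\<dots> = Re (ip a b (cfun \<Psi>h) (cfun d\<Psi>))"
      using e\<Phi>[OF dX(3)] by simp
    finally show ?thesis unfolding rep(3,6) form(2)[OF X(6,5)] by simp
  qed
  have 3: "Re (ip a b (cfun d\<Psi>) (cfun d\<Phi>)) + \<gamma> * ((B (cfun (\<Phi> (n + 1))) - B (cfun (\<Phi> n))) / (2 * \<tau>))
      + \<eta>\<^sup>2 * ((Q (cfun (\<Phi> (n + 1))) - Q (cfun (\<Phi> n))) / (2 * \<tau>)) = Pt * Re (ip a b g (cfun d\<Phi>))"
  proof -
    have "Re (ip a b (cfun d\<Psi>) (cfun d\<Phi>) + complex_of_real \<gamma> * bform a b \<alpha> (cfun \<Phi>h) (cfun d\<Phi>)
          + complex_of_real (\<eta>\<^sup>2) * ip a b (cfun \<Phi>h) (cfun d\<Phi>)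
          - complex_of_real Pt * ip a b g (cfun d\<Phi>)) = 0"
      using e\<Psi>[OF dX(2)] by simp
    then have "Re (ip a b (cfun d\<Psi>) (cfun d\<Phi>)) + \<gamma> * Re (bform a b \<alpha> (cfun \<Phi>h) (cfun d\<Phi>))
      + \<eta>\<^sup>2 * Re (ip a b (cfun \<Phi>h) (cfun d\<Phi>)) = Pt * Re (ip a b g (cfun d\<Phi>))"
      by (simp add: Re_power2)
    then show ?thesis unfolding rep(2,5) form[OF X(4,3)] by simp
  qed
  have "Re (complex_of_real ((ln (P (n + 1)) - ln (P n)) / \<tau>)) = Re (4 * complex_of_real Pt * complex_of_real (Re (ip a b f dU))
          + 2 * complex_of_real Pt * ip a b g (cfun d\<Phi>))"
    using eP by (rule arg_cong)
  then have 4: "(ln (P (n + 1)) - ln (P n)) / \<tau> = 2 * (2 * Pt * Re (ip a b f dU)) + 2 * (Pt * Re (ip a b g (cfun d\<Phi>)))"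
    by simp
  have "(ln (P (n + 1)) - ln (P n)) / \<tau> = (lam * (B (U (n + 1)) - B (U n)) + (Q (cfun (\<Psi> (n + 1))) - Q (cfun (\<Psi> n)))
     + \<gamma> * (B (cfun (\<Phi> (n + 1))) - B (cfun (\<Phi> n))) + \<eta>\<^sup>2 * (Q (cfun (\<Phi> (n + 1))) - Q (cfun (\<Phi> n)))) / \<tau>"
    unfolding 4 1[symmetric] 3[symmetric] 2[symmetric] using \<tau> by (simp add: field_simps)
  then have balance: "ln (P (n + 1)) - ln (P n) = lam * (B (U (n + 1)) - B (U n)) + (Q (cfun (\<Psi> (n + 1))) - Q (cfun (\<Psi> n)))
     + \<gamma> * (B (cfun (\<Phi> (n + 1))) - B (cfun (\<Phi> n))) + \<eta>\<^sup>2 * (Q (cfun (\<Phi> (n + 1))) - Q (cfun (\<Phi> n)))"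
    using \<tau> by simp
  have seminorm: "(frac_seminorm a b \<alpha> u)\<^sup>2 = B u" if u: "u \<in> X0_space a b \<alpha> N" for u
  proof -
    obtain p where "poly_vanishing_at_ends a b u p" using X0_space_vanishes_at_ends[OF ab \<alpha> u] .
    from Re_bform_nonneg[OF ab \<alpha> this] show ?thesis by (simp add: frac_seminorm_def B_def)
  qed
  show ?thesis
    unfolding energy_def l2norm_square seminorm[OF X(1)] seminorm[OF X(2)] seminorm[OF X(3)] seminorm[OF X(4)]
    using balance by (simp add: Q_def algebra_simps)
qed

theorem theorem4p1:
  fixes a b \<alpha> T lam \<kappa>1 \<kappa>2 \<gamma> \<eta> :: real and N Nt :: nat
    and u0 :: "real \<Rightarrow> complex" and \<phi>0 \<phi>1 :: "real \<Rightarrow> real"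
    and U :: "nat \<Rightarrow> real \<Rightarrow> complex" and \<Phi> \<Psi> :: "nat \<Rightarrow> real \<Rightarrow> real" and P :: "nat \<Rightarrow> real"
  assumes "a < b" and "1 < \<alpha>" and "\<alpha> < 2" and "T > 0" and "Nt \<ge> 1"
    and "lam \<ge> 0" and "\<kappa>1 \<ge> 0" and "\<kappa>2 \<ge> 0" and "\<gamma> \<ge> 0"
    and "smooth_on u0 {a<..<b}" and "u0 \<in> H0_space (\<alpha> / 2) a b"
    and "smooth_on \<phi>0 {a<..<b}" and "cfun \<phi>0 \<in> H0_space (\<alpha> / 2) a b"
    and "smooth_on \<phi>1 {a<..<b}" and "cfun \<phi>1 \<in> H0_space (\<alpha> / 2) a b"
    and "esav_sgm_solution a b \<alpha> N lam \<kappa>1 \<kappa>2 \<gamma> \<eta> T Nt u0 \<phi>0 \<phi>1 U \<Phi> \<Psi> P"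
  shows "\<forall>n\<le>Nt. energy a b \<alpha> lam \<gamma> \<eta> U \<Phi> \<Psi> P n = energy a b \<alpha> lam \<gamma> \<eta> U \<Phi> \<Psi> P 0"
proof (intro allI impI)
  fix n assume "n \<le> Nt"
  note sol = assms(16)[unfolded esav_sgm_solution_def]
  have \<tau>: "0 < T / real Nt" using assms(4,5) by simp
  have X: "U m \<in> X0_space a b \<alpha> N" "cfun (\<Phi> m) \<in> X0_space a b \<alpha> N" "cfun (\<Psi> m) \<in> X0_space a b \<alpha> N"
    if "m \<le> Nt" for m
    using sol that by blast+
  have step: "\<exists>Ut \<Phi>t Pt. esav_step a b \<alpha> N lam \<kappa>1 \<kappa>2 \<gamma> \<eta> (T / real Nt) U \<Phi> \<Psi> P m Ut \<Phi>t Pt"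
    if "m < Nt" for m
  proof (cases "m = 0")
    case True
    then show ?thesis using sol by blast
  next
    case False
    then have "1 \<le> m \<and> m < Nt" using that by simp
    then show ?thesis using sol by blast
  qed
  show "energy a b \<alpha> lam \<gamma> \<eta> U \<Phi> \<Psi> P n = energy a b \<alpha> lam \<gamma> \<eta> U \<Phi> \<Psi> P 0"
    using \<open>n \<le> Nt\<close>
  proof (induction n)
    case (Suc n)
    then have n: "n < Nt" "n \<le> Nt" "n + 1 \<le> Nt" by auto
    obtain Ut \<Phi>t Pt where "esav_step a b \<alpha> N lam \<kappa>1 \<kappa>2 \<gamma> \<eta> (T / real Nt) U \<Phi> \<Psi> P n Ut \<Phi>t Pt"
      using step[OF n(1)] by blast
    from energy_step[OF assms(1-3) \<tau> X(1)[OF n(2)] X(1)[OF n(3)] X(2)[OF n(2)] X(2)[OF n(3)]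
        X(3)[OF n(2)] X(3)[OF n(3)] this]
    show ?case using Suc by simp
  qed simp
qed

end
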